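(* Let $n\ge2$. For every singular framed link $\Gamma$ in $\mathbb{R}^3$, $(\Gamma)_n\in\mathbb{Z}[q^{\pm1}]$. Moreover, let $L_+,L_-,L_0,L_\times$ denote singular link diagrams identical outside a small disc in which they are respectively a positive crossing, a negative crossing, the orientation-respecting smoothing, and a $4$-valent singular vertex (with the same two incoming and two outgoing ends). Then (i) $(L_+)_n=q\,(L_0)_n-(L_\times)_n$; (ii) $(L_-)_n=q^{-1}(L_0)_n-(L_\times)_n$; (iii) adding a small curl with a positive crossing to an arc multiplies $(\cdot)_n$ by $q^{n}$, and adding a small curl with a negative crossing multiplies it by $q^{-n}$; (iv) $(L\cup O)_n=[n](L)_n$ for $O$ the trivial framed knot unlinked with $L$; (v) $(\emptyset)_n=1$, and consequently $(O)_n=[n]$.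
   Context: An $n$-web is an oriented surface embedded in $\mathbb{R}^3$ composed of finitely many directed annuli, directed bands and discs. A band is an embedded square $[0,1]\times[0,1]$ directed from its source $[0,1]\times\{0\}$ to its target $[0,1]\times\{1\}$. The annuli, discs and interiors of bands are disjoint; sources and targets of bands are pairwise disjoint and lie in boundaries of discs; the boundary of each disc contains either exactly $n$ sources and no targets of bands (the disc is a source of the web) or exactly $n$ targets and no sources (a sink); each disc has a marked boundary point outside the bands. An $n$-web diagram is an orientation-preserving projection to $\mathbb{R}^2$ which is an embedding except for finitely many transverse crossings (with over/under information) away from the discs. The bands at a disc are ordered $1,\dots,n$ starting at the marked point, clockwise for a sink and counter-clockwise for a source. Notation: $[k]=\frac{q^k-q^{-k}}{q-q^{-1}}$, $[k]!=[1]\cdots[k]$, $[0]!=1$; for $\sigma\in S_n$, $l(\sigma)$ is the number of inversions and $b_\sigma$ is the positive braid with $l(\sigma)$ crossings on $n$ downward strands representing $\sigma$. $\langle\cdot\rangle_n\in\mathbb{Z}[q^{\pm1/n}]$ is the unique isotopy invariant of $n$-webs such that: (1) $q^{1/n}\langle\Gamma_+\rangle_n-q^{-1/n}\langle\Gamma_-\rangle_n=(q-q^{-1})\langle\Gamma_0\rangle_n$ for diagrams differing only by a positive crossing, negative crossing, oriented smoothing; (2) adding a small curl with a positive (negative) crossing multiplies the bracket by $q^{n-1/n}$ (by $q^{1/n-n}$); (3) if in some disc $\Gamma$ consists of $n$ parallel downward strands running from the top into a sink with marked point at its bottom, and below it a source with marked point at its top with $n$ parallel downward strands running to the bottom, then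 $\langle\Gamma\rangle_n=q^{n(n-1)}\sum_{\sigma\in S_n}(-q^{(1-n)/n})^{l(\sigma)}\langle\Gamma_\sigma\rangle_n$, where $\Gamma_\sigma$ has the disc content replaced by $b_\sigma$; (4) adding an unlinked trivial framed knot multiplies the bracket by $[n]$; (5) $\langle\emptyset\rangle_n=1$. A singular framed link is a framed (ribbon) oriented graph in $\mathbb{R}^3$ (annuli allowed) each of whose vertices is $4$-valent with two incoming and two outgoing edges, the two incoming ones being adjacent in the cyclic order (as at a double point of an oriented diagram). In particular, oriented framed links are singular framed links. For a singular framed link $L$, the $n$-web $\Psi_n(L)$ is obtained by replacing each vertex, drawn with both incoming strands arriving from the top and both outgoing strands leaving at the bottom, by one sink and one source such that: the incoming strands (left to right) are the first and second band at the sink; the outgoing strands (left to right) are the first and second band at the source; and for $3\le i\le n$ the $i$-th band at the source is the $i$-th band at the sink, these $n-2$ bands being parallel, directed from source to sink, without crossings. For a singular link diagram $D$, $$(D)_n=\frac{\langle\Psi_n(D)\rangle_n}{\left([n-2]!\,q^{n(n-1)/2}\right)^{v(D)}}\cdot q^{w(D)/n},$$ where $v(D)$ is the number of $4$-valent vertices and $w(D)$ is the number of positive minus the number of negative crossings of $D$. *)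

theory Defs
  imports
    "HOL-Combinatorics.Permutations"
    "HOL-Computational_Algebra.Formal_Laurent_Series"
begin

section \<open>Diagrams\<close>

text \<open>
  By a planar isotopy a diagram is put in Morse position with respect to the height function so
  that every crossing and every node (a vertex of a singular link, or a disc of a web) is upright,
  i.e. all strands at it run downwards. It is then read from top to bottom as a list of slices:
  \<open>(i, p)\<close> is the elementary piece \<open>p\<close> with \<open>i\<close> vertical strands to its left and any number of
  vertical strands to its right. Strands stand for bands parallel to the plane of
  projection (blackboard framing), and closed curves for annuli.
\<close>

datatype strand = Down | Up

fun opp :: "strand \<Rightarrow> strand" where
  "opp Down = Up"
| "opp Up = Down"

text \<open>
  \<open>Cap d\<close> is a local maximum and \<open>Cup d\<close> a local minimum, in both cases with left leg of
  direction \<open>d\<close>. In \<open>Pos\<close> and \<open>Neg\<close> two downward strands cross; the over-strand runs from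
  top right to bottom left in the positive crossing \<open>Pos\<close> and from top left to bottom right in
  the negative crossing \<open>Neg\<close>.
\<close>

datatype 'v piece = Cap strand | Cup strand | Pos | Neg | Node 'v

type_synonym 'v diagram = "(nat \<times> 'v piece) list"

text \<open>The strands at the top and at the bottom of a node, from left to right.\<close>

type_synonym 'v ends = "'v \<Rightarrow> strand list \<times> strand list"

fun top_of :: "'v ends \<Rightarrow> 'v piece \<Rightarrow> strand list" where
  "top_of e (Cap d) = []"
| "top_of e (Cup d) = [d, opp d]"
| "top_of e Pos = [Down, Down]"
| "top_of e Neg = [Down, Down]"
| "top_of e (Node v) = fst (e v)"

fun bottom_of :: "'v ends \<Rightarrow> 'v piece \<Rightarrow> strand list" where
  "bottom_of e (Cap d) = [d, opp d]"
| "bottom_of e (Cup d) = []"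
| "bottom_of e Pos = [Down, Down]"
| "bottom_of e Neg = [Down, Down]"
| "bottom_of e (Node v) = snd (e v)"

text \<open>\<open>tangle e s D t\<close>: the slices \<open>D\<close> fit together, starting with the strands \<open>s\<close> and ending
  with the strands \<open>t\<close>.\<close>

inductive tangle :: "'v ends \<Rightarrow> strand list \<Rightarrow> 'v diagram \<Rightarrow> strand list \<Rightarrow> bool"
  for e :: "'v ends" where
  empty: "tangle e s [] s"
| slice: "tangle e (l @ bottom_of e p @ r) D t \<Longrightarrow>
          tangle e (l @ top_of e p @ r) ((length l, p) # D) t"

definition closed_diagram :: "'v ends \<Rightarrow> 'v diagram \<Rightarrow> bool" where
  "closed_diagram e D \<longleftrightarrow> tangle e [] D []"

text \<open>\<open>P @ placed i A @ Q\<close> is a diagram which, in some disc, looks like \<open>A\<close>; diagrams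
  \<open>P @ placed i A @ Q\<close> and \<open>P @ placed i B @ Q\<close> are identical outside this disc.\<close>

definition placed :: "nat \<Rightarrow> 'v diagram \<Rightarrow> 'v diagram" where
  "placed i A = map (\<lambda>(j, p). (i + j, p)) A"

definition writhe :: "'v diagram \<Rightarrow> int" where
  "writhe D = int (length (filter (\<lambda>(i, p). p = Pos) D))
            - int (length (filter (\<lambda>(i, p). p = Neg) D))"

definition num_nodes :: "'v diagram \<Rightarrow> nat" where
  "num_nodes D = length (filter (\<lambda>(i, p). \<exists>v. p = Node v) D)"

text \<open>The two small curls with crossing \<open>X\<close> on a downward strand, lying on its right and on its
  left. As crossings and nodes are upright, every arc of a diagram has a downward strand.\<close>

definition curl_right :: "'v piece \<Rightarrow> 'v diagram" where
  "curl_right X = [(1, Cap Down), (0, X), (1, Cup Down)]"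

definition curl_left :: "'v piece \<Rightarrow> 'v diagram" where
  "curl_left X = [(0, Cap Up), (1, X), (0, Cup Up)]"

text \<open>The diagram without crossings of an unknot; the parameter is the orientation.\<close>

definition circle :: "strand \<Rightarrow> 'v diagram" where
  "circle d = [(0, Cap d), (0, Cup d)]"


section \<open>Singular links and webs\<close>

datatype vertex = Double_Point

fun vertex_ends :: "vertex ends" where
  "vertex_ends Double_Point = ([Down, Down], [Down, Down])"

definition singular_diagram :: "vertex diagram \<Rightarrow> bool" where
  "singular_diagram D \<longleftrightarrow> closed_diagram vertex_ends D"

text \<open>
  A sink has its marked point at its bottom and its bands at its top, so that the clockwise
  order of the bands is the order from left to right. A source has its marked point at its top
  and its bands at its bottom, so that their counter-clockwise order is again from left to right.
\<close>

datatype disc = Sink | Source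

fun disc_ends :: "nat \<Rightarrow> disc ends" where
  "disc_ends n Sink = (replicate n Down, [])"
| "disc_ends n Source = ([], replicate n Down)"

definition web_diagram :: "nat \<Rightarrow> disc diagram \<Rightarrow> bool" where
  "web_diagram n D \<longleftrightarrow> closed_diagram (disc_ends n) D"

text \<open>
  The replacement of a vertex: strands \<open>3..n\<close> leave the source, pass to the right of both
  discs as \<open>n - 2\<close> parallel upward strands, and enter the sink from above.
\<close>

definition resolved_vertex :: "nat \<Rightarrow> disc diagram" where
  "resolved_vertex n =
     map (\<lambda>k. (2 + k, Cap Down)) [0..<n - 2]
     @ [(0, Node Sink), (0, Node Source)]
     @ map (\<lambda>k. (2 + k, Cup Down)) (rev [0..<n - 2])"

fun web_slice :: "nat \<Rightarrow> nat \<times> vertex piece \<Rightarrow> disc diagram" where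
  "web_slice n (i, Cap d) = [(i, Cap d)]"
| "web_slice n (i, Cup d) = [(i, Cup d)]"
| "web_slice n (i, Pos) = [(i, Pos)]"
| "web_slice n (i, Neg) = [(i, Neg)]"
| "web_slice n (i, Node Double_Point) = placed i (resolved_vertex n)"

definition web_of :: "nat \<Rightarrow> vertex diagram \<Rightarrow> disc diagram" where
  "web_of n D = concat (map (web_slice n) D)"


section \<open>Isotopy of webs\<close>

text \<open>
  Isotopy is generated by the local moves for diagrams of ribbon graphs in Morse position
  (Turaev, Reshetikhin--Turaev).

  A crossing seen sideways. In \<open>sideways_left X\<close> the strands at the top run down and up, at the
  bottom up and down; in \<open>sideways_right X\<close> it is the other way round.
\<close>

definition sideways_left :: "'v piece \<Rightarrow> 'v diagram" where
  "sideways_left X = [(0, Cap Up), (1, X), (2, Cup Down)]"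

definition sideways_right :: "'v piece \<Rightarrow> 'v diagram" where
  "sideways_right X = [(2, Cap Down), (1, X), (0, Cup Up)]"

text \<open>The piece \<open>p\<close> turned upside down, clockwise or counter-clockwise, so that all its strands
  run upwards.\<close>

definition turned_left :: "'v ends \<Rightarrow> 'v piece \<Rightarrow> 'v diagram" where
  "turned_left e p = (let a = length (top_of e p); b = length (bottom_of e p) in
     map (\<lambda>k. (k, Cap Up)) [0..<a] @ [(a, p)] @ map (\<lambda>k. (a + k, Cup Down)) (rev [0..<b]))"

definition turned_right :: "'v ends \<Rightarrow> 'v piece \<Rightarrow> 'v diagram" where
  "turned_right e p = (let a = length (top_of e p); b = length (bottom_of e p) in
     map (\<lambda>k. (b + k, Cap Down)) [0..<a] @ [(b, p)] @ map (\<lambda>k. (k, Cup Up)) (rev [0..<b]))"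

inductive web_move :: "nat \<Rightarrow> disc diagram \<Rightarrow> disc diagram \<Rightarrow> bool" for n :: nat where
  \<comment> \<open>planar isotopy\<close>
  exchange: "web_move n
     [(0, g), (length (bottom_of (disc_ends n) g) + m, h)]
     [(length (top_of (disc_ends n) g) + m, h), (0, g)]"
| zigzag_left: "web_move n [(1, Cap (opp d)), (0, Cup d)] []"
| zigzag_right: "web_move n [(0, Cap d), (1, Cup (opp d))] []"
| turn: "p \<in> {Pos, Neg, Node Sink, Node Source} \<Longrightarrow>
     web_move n (turned_left (disc_ends n) p) (turned_right (disc_ends n) p)"
  \<comment> \<open>framed first Reidemeister move\<close>
| curl: "X \<in> {Pos, Neg} \<Longrightarrow> web_move n (curl_right X) (curl_left X)"
  \<comment> \<open>second Reidemeister move, for parallel and for antiparallel strands\<close>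
| cancel: "{X, Y} = {Pos, Neg} \<Longrightarrow> web_move n [(0, X), (0, Y)] []"
| cancel_down_up: "{X, Y} = {Pos, Neg} \<Longrightarrow> web_move n (sideways_left X @ sideways_right Y) []"
| cancel_up_down: "{X, Y} = {Pos, Neg} \<Longrightarrow> web_move n (sideways_right X @ sideways_left Y) []"
  \<comment> \<open>third Reidemeister move\<close>
| braid: "web_move n [(0, Pos), (1, Pos), (0, Pos)] [(1, Pos), (0, Pos), (1, Pos)]"
  \<comment> \<open>a strand passes over or under a disc\<close>
| pass_sink: "X \<in> {Pos, Neg} \<Longrightarrow>
     web_move n (map (\<lambda>k. (k, X)) [0..<n] @ [(0, Node Sink)]) [(1, Node Sink)]"
| pass_source: "X \<in> {Pos, Neg} \<Longrightarrow>
     web_move n ([(1, Node Source)] @ map (\<lambda>k. (k, X)) [0..<n]) [(0, Node Source)]"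

inductive web_step :: "nat \<Rightarrow> disc diagram \<Rightarrow> disc diagram \<Rightarrow> bool" for n :: nat where
  "web_move n A B \<Longrightarrow> web_diagram n (P @ placed i A @ Q) \<Longrightarrow> web_diagram n (P @ placed i B @ Q) \<Longrightarrow>
   web_step n (P @ placed i A @ Q) (P @ placed i B @ Q)"

definition web_isotopic :: "nat \<Rightarrow> disc diagram \<Rightarrow> disc diagram \<Rightarrow> bool" where
  "web_isotopic n = equivclp (web_step n)"


section \<open>Coefficients\<close>

text \<open>
  Coefficients are taken in the field of formal Laurent series over the rationals in the variable
  \<open>root_q\<close>, the \<open>n\<close>-th root of \<open>q\<close>. It contains the ring of integral Laurent polynomials in
  \<open>root_q\<close> and its field of fractions.
\<close>

abbreviation root_q :: "rat fls" where
  "root_q \<equiv> fls_X"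

definition qvar :: "nat \<Rightarrow> rat fls" where
  "qvar n = root_q ^ n"

definition laurent_root_q :: "rat fls set" where
  "laurent_root_q = {f. finite {k. fls_nth f k \<noteq> 0} \<and> (\<forall>k. fls_nth f k \<in> \<int>)}"

definition laurent_q :: "nat \<Rightarrow> rat fls set" where
  "laurent_q n = {f \<in> laurent_root_q. \<forall>k. fls_nth f k \<noteq> 0 \<longrightarrow> int n dvd k}"

definition qint :: "nat \<Rightarrow> nat \<Rightarrow> rat fls" where
  "qint n k = (qvar n powi int k - qvar n powi (- int k)) / (qvar n - inverse (qvar n))"

definition qfact :: "nat \<Rightarrow> nat \<Rightarrow> rat fls" where
  "qfact n k = (\<Prod>j = 1..k. qint n j)"


section \<open>The bracket of webs\<close>

text \<open>Permutations of \<open>{1, \<dots>, n}\<close> are shifted to permutations of \<open>{..<n}\<close>.\<close>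

definition inversions :: "nat \<Rightarrow> (nat \<Rightarrow> nat) \<Rightarrow> nat" where
  "inversions n \<sigma> = card {(i, j). i < j \<and> j < n \<and> \<sigma> j < \<sigma> i}"

text \<open>
  \<open>positive_braid n \<sigma> b\<close>: \<open>b\<close> is a positive braid on \<open>n\<close> downward strands with
  \<open>inversions n \<sigma>\<close> crossings whose strand starting at top position \<open>j\<close> ends at bottom position
  \<open>\<sigma> j\<close>. The list \<open>ks\<close> contains the positions of the crossings from top to bottom.
\<close>

definition positive_braid :: "nat \<Rightarrow> (nat \<Rightarrow> nat) \<Rightarrow> disc diagram \<Rightarrow> bool" where
  "positive_braid n \<sigma> b \<longleftrightarrow>
     (\<exists>ks. b = map (\<lambda>k. (k, Pos)) ks \<and> (\<forall>k \<in> set ks. Suc k < n) \<and>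
           fold (\<lambda>k. transpose k (Suc k)) ks = \<sigma> \<and> length ks = inversions n \<sigma>)"

text \<open>
  Isotopy invariants of webs with the defining properties of the bracket. In the third property
  \<open>b\<close> chooses a braid for each permutation; all choices are isotopic.
\<close>

definition web_bracket_axioms :: "nat \<Rightarrow> (disc diagram \<Rightarrow> rat fls) \<Rightarrow> bool" where
  "web_bracket_axioms n br \<longleftrightarrow>
     (\<forall>D. web_diagram n D \<longrightarrow> br D \<in> laurent_root_q) \<and>
     (\<forall>D D'. web_diagram n D \<longrightarrow> web_diagram n D' \<longrightarrow> web_isotopic n D D' \<longrightarrow> br D = br D') \<and>
     (\<forall>P i Q. web_diagram n (P @ placed i [(0, Pos)] @ Q) \<longrightarrow>
        root_q * br (P @ placed i [(0, Pos)] @ Q) - inverse root_q * br (P @ placed i [(0, Neg)] @ Q)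
          = (qvar n - inverse (qvar n)) * br (P @ Q)) \<and>
     (\<forall>P i Q. \<forall>curl \<in> {curl_right, curl_left}.
        (web_diagram n (P @ placed i (curl Pos) @ Q) \<longrightarrow>
           br (P @ placed i (curl Pos) @ Q) = root_q powi (int n * int n - 1) * br (P @ Q)) \<and>
        (web_diagram n (P @ placed i (curl Neg) @ Q) \<longrightarrow>
           br (P @ placed i (curl Neg) @ Q) = root_q powi (1 - int n * int n) * br (P @ Q))) \<and>
     (\<forall>P i Q b. web_diagram n (P @ placed i [(0, Node Sink), (0, Node Source)] @ Q) \<longrightarrow>
        (\<forall>\<sigma>. \<sigma> permutes {..<n} \<longrightarrow> positive_braid n \<sigma> (b \<sigma>)) \<longrightarrow>
        br (P @ placed i [(0, Node Sink), (0, Node Source)] @ Q)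
          = qvar n ^ (n * (n - 1)) *
            (\<Sum>\<sigma> | \<sigma> permutes {..<n}.
               (- (root_q powi (1 - int n))) ^ inversions n \<sigma> * br (P @ placed i (b \<sigma>) @ Q))) \<and>
     (\<forall>P i Q d. web_diagram n (P @ placed i (circle d) @ Q) \<longrightarrow>
        br (P @ placed i (circle d) @ Q) = qint n n * br (P @ Q)) \<and>
     br [] = 1"

definition web_bracket :: "nat \<Rightarrow> (disc diagram \<Rightarrow> rat fls) \<Rightarrow> bool" where
  "web_bracket n br \<longleftrightarrow> web_bracket_axioms n br \<and>
     (\<forall>br'. web_bracket_axioms n br' \<longrightarrow> (\<forall>D. web_diagram n D \<longrightarrow> br' D = br D))"

text \<open>The bracket of singular link diagrams obtained from a bracket of webs.\<close>

definition singular_bracket ::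
  "nat \<Rightarrow> (disc diagram \<Rightarrow> rat fls) \<Rightarrow> vertex diagram \<Rightarrow> rat fls" where
  "singular_bracket n br D =
     br (web_of n D) / (qfact n (n - 2) * qvar n ^ (n * (n - 1) div 2)) ^ num_nodes D
     * root_q powi writhe D"

end

theory Submission
  imports Defs
begin

text \<open>
  The vertex relation (3), applied to the sink and source of a resolved vertex, turns the web into
  the closure of \<open>n - 2\<close> strands of the \<open>q\<close>-antisymmetrizer on \<open>n\<close> strands. The antisymmetrizer
  absorbs a weighted crossing at the cost of a factor \<open>- q\<^sup>-\<^sup>1\<close>, so closing the last of \<open>m + 1\<close>
  strands multiplies the antisymmetrizer on \<open>m\<close> strands by
  \<open>[n] - q\<^sup>n\<^sup>-\<^sup>m [m] = q\<^sup>-\<^sup>m [n - m]\<close>. After \<open>n - 2\<close> closures a combination of the smoothing and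
  the positive crossing is left, which is (i).

  By (i) integrality reduces to diagrams without vertices. There one has to see that the exponents
  of \<open>root_q\<close> in the bracket are congruent to minus the writhe modulo \<open>n\<close>. The writhe modulo \<open>n\<close>
  is an isotopy invariant of webs, and all relations for the bracket are homogeneous for the
  resulting grading. Hence the homogeneous part of the bracket satisfies the same axioms, and by
  uniqueness it is the whole bracket.
\<close>

section \<open>Diagrams\<close>

lemma tangle_Nil_iff [simp]: "tangle e s [] t \<longleftrightarrow> s = t"
  by (auto elim: tangle.cases intro: tangle.intros)

lemma tangle_Cons_iff:
  "tangle e s ((i, p) # D) t \<longleftrightarrow>
     (\<exists>l r. s = l @ top_of e p @ r \<and> length l = i \<and> tangle e (l @ bottom_of e p @ r) D t)"
  (is "?A \<longleftrightarrow> ?B")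
proof
  assume ?A
  then show ?B by (cases rule: tangle.cases) blast
next
  assume ?B
  then show ?A by (auto intro: tangle.slice)
qed

lemma tangle_append_iff:
  "tangle e s (A @ B) t \<longleftrightarrow> (\<exists>u. tangle e s A u \<and> tangle e u B t)"
proof (induction A arbitrary: s)
  case (Cons a A)
  obtain i p where "a = (i, p)" by (cases a)
  then show ?case by (auto simp: tangle_Cons_iff Cons.IH)
qed simp

lemma placed_simps [simp]:
  "placed i [] = []" "placed i ((j, p) # A) = (i + j, p) # placed i A"
  "placed i (A @ B) = placed i A @ placed i B" "placed i (placed j A) = placed (i + j) A"
  by (auto simp: placed_def)

lemma tangle_placed:
  assumes "tangle e s A t"
  shows "tangle e (l @ s @ r) (placed (length l) A) (l @ t @ r)"
  using assms
proof induction
  case (slice l' p r' D t)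
  have "tangle e ((l @ l') @ top_of e p @ r' @ r) ((length (l @ l'), p) # placed (length l) D) (l @ t @ r)"
    using slice.IH by (intro tangle.slice) simp
  then show ?case by simp
qed simp

lemma closed_placed:
  assumes "tangle e [] P (l @ s @ r)" "tangle e s A t" "tangle e (l @ t @ r) Q []"
  shows "closed_diagram e (P @ placed (length l) A @ Q)"
  unfolding closed_diagram_def tangle_append_iff
  using assms tangle_placed[OF assms(2)] by blast

text \<open>Each new cap opens between the downward and the upward strands already present. The arcs
  are therefore nested, and their right legs are parallel.\<close>

lemma tangle_caps:
  "tangle e (replicate k Down @ r) (map (\<lambda>j. (k + j, Cap Down)) [0..<m])
     (replicate (k + m) Down @ replicate m Up @ r)"
proof (induction m)
  case (Suc m)
  have "tangle e (replicate (k + m) Down @ [] @ replicate m Up @ r) [(length (replicate (k + m) Down), Cap Down)]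
     (replicate (k + m) Down @ [Down, Up] @ replicate m Up @ r)"
    unfolding tangle_Cons_iff by fastforce
  then have "tangle e (replicate (k + m) Down @ replicate m Up @ r) [(k + m, Cap Down)]
     (replicate (k + Suc m) Down @ replicate (Suc m) Up @ r)"
    by (simp add: replicate_app_Cons_same)
  with Suc show ?case by (auto simp: tangle_append_iff simp del: replicate_Suc)
qed simp

lemma tangle_cups:
  "tangle e (replicate (k + m) Down @ replicate m Up @ r)
     (map (\<lambda>j. (k + j, Cup Down)) (rev [0..<m])) (replicate k Down @ r)"
proof (induction m)
  case (Suc m)
  have "tangle e (replicate (k + m) Down @ [Down, Up] @ replicate m Up @ r) [(length (replicate (k + m) Down), Cup Down)]
     (replicate (k + m) Down @ [] @ replicate m Up @ r)"
    unfolding tangle_Cons_iff by fastforce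
  then have "tangle e (replicate (k + Suc m) Down @ replicate (Suc m) Up @ r) [(k + m, Cup Down)]
     (replicate (k + m) Down @ replicate m Up @ r)"
    by (simp add: replicate_app_Cons_same)
  then have "tangle e (replicate (k + Suc m) Down @ replicate (Suc m) Up @ r)
     ([(k + m, Cup Down)] @ map (\<lambda>j. (k + j, Cup Down)) (rev [0..<m])) (replicate k Down @ r)"
    using Suc unfolding tangle_append_iff by blast
  then show ?case by simp
qed simp

text \<open>The presentation used in \<open>positive_braid\<close>. It lets braid and Hecke
  relations be handled on lists of positions instead of on diagrams.\<close>

definition braid_word :: "nat list \<Rightarrow> 'v diagram" where
  "braid_word ks = map (\<lambda>k. (k, Pos)) ks"

lemma braid_word_simps [simp]:
  "braid_word [] = []" "braid_word (k # ks) = (k, Pos) # braid_word ks"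
  "braid_word (ks @ ks') = braid_word ks @ braid_word ks'"
  by (auto simp: braid_word_def)

lemma replicate_split: "k + m + r = N \<Longrightarrow> replicate N x = replicate k x @ replicate m x @ replicate r x"
  by (metis add.assoc replicate_add)

lemma tangle_crossing:
  assumes "Suc k < N" "X \<in> {Pos, Neg}"
  shows "tangle e (replicate N Down) [(k, X)] (replicate N Down)"
proof -
  have "replicate N Down = replicate k Down @ [Down, Down] @ replicate (N - k - 2) Down"
    using assms replicate_split[of k 2 "N - k - 2" N Down] by (simp add: numeral_2_eq_2)
  then show ?thesis using assms unfolding tangle_Cons_iff
    by (intro exI[of _ "replicate k Down"] exI[of _ "replicate (N - k - 2) Down"]) auto
qed

lemma tangle_braid_word:
  assumes "\<forall>k \<in> set ks. Suc k < N"
  shows "tangle e (replicate N Down) (braid_word ks) (replicate N Down)"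
  using assms
proof (induction ks)
  case (Cons k ks)
  then have "tangle e (replicate N Down) ([(k, Pos)] @ braid_word ks) (replicate N Down)"
    using tangle_crossing[of k N Pos e] unfolding tangle_append_iff by auto
  then show ?case by simp
qed simp

lemma tangle_resolved_vertex:
  assumes "n \<ge> 2"
  shows "tangle (disc_ends n) [Down, Down] (resolved_vertex n) [Down, Down]"
proof -
  obtain m where n: "n = Suc (Suc m)" using assms by (metis Suc_le_D numeral_2_eq_2 Suc_le_mono)
  let ?e = "disc_ends n" and ?t = "replicate n Down @ replicate m Up"
  have "tangle ?e ?t [(0, Node Sink), (0, Node Source)] ?t"
    unfolding tangle_Cons_iff by auto
  moreover have "tangle ?e [Down, Down] (map (\<lambda>k. (2 + k, Cap Down)) [0..<m]) ?t"
    using tangle_caps[of ?e 2 "[]" m] by (simp add: numeral_2_eq_2 n)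
  moreover have "tangle ?e ?t (map (\<lambda>k. (2 + k, Cup Down)) (rev [0..<m])) [Down, Down]"
    using tangle_cups[of ?e 2 m "[]"] by (simp add: numeral_2_eq_2 n)
  moreover have "n - 2 = m" using n by simp
  ultimately show ?thesis unfolding resolved_vertex_def tangle_append_iff by metis
qed

section \<open>Passage from singular diagrams to webs\<close>

lemma web_slice_Node [simp]: "web_slice n (i, Node v) = placed i (resolved_vertex n)"
  by (cases v) simp

lemma web_of_simps [simp]:
  "web_of n [] = []" "web_of n (a # D) = web_slice n a @ web_of n D"
  "web_of n (D @ D') = web_of n D @ web_of n D'"
  by (auto simp: web_of_def)

lemma tangle_web_of:
  assumes "n \<ge> 2" "tangle vertex_ends s D t"
  shows "tangle (disc_ends n) s (web_of n D) t"
  using assms(2)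
proof induction
  case (slice l p r D t)
  show ?case
  proof (cases "\<exists>v. p = Node v")
    case True
    then have p: "p = Node Double_Point" by (auto intro: vertex.exhaust)
    show ?thesis using slice.IH tangle_placed[OF tangle_resolved_vertex[OF assms(1)], of l r]
      by (auto simp: p tangle_append_iff)
  next
    case False
    \<comment> \<open>\<open>p'\<close> is the piece \<open>p\<close> itself, read at the type of
      web pieces; the two kinds of diagram differ only in their nodes.\<close>
    then have "\<exists>p'. top_of (disc_ends n) p' = top_of vertex_ends p \<and>
       bottom_of (disc_ends n) p' = bottom_of vertex_ends p \<and> web_slice n (length l, p) = [(length l, p')]"
      by (cases p) (auto intro: exI[of _ "Cap _"] exI[of _ "Cup _"] exI[of _ Pos] exI[of _ Neg])
    then show ?thesis using slice.IH by (metis append_Cons append_Nil web_of_simps(2) tangle.slice)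
  qed
qed simp

lemma web_diagram_web_of:
  "n \<ge> 2 \<Longrightarrow> singular_diagram D \<Longrightarrow> web_diagram n (web_of n D)"
  unfolding web_diagram_def singular_diagram_def closed_diagram_def by (rule tangle_web_of)

section \<open>Writhe and number of nodes\<close>

lemma writhe_simps [simp]:
  "writhe [] = 0" "writhe (D @ D') = writhe D + writhe D'" "writhe (placed i D) = writhe D"
  "writhe ((i, p) # D) = (if p = Pos then 1 else if p = Neg then -1 else 0) + writhe D"
  by (auto simp: writhe_def placed_def filter_map o_def case_prod_unfold)

lemma num_nodes_simps [simp]:
  "num_nodes [] = 0" "num_nodes (D @ D') = num_nodes D + num_nodes D'"
  "num_nodes (placed i D) = num_nodes D"
  "num_nodes ((i, p) # D) = (if \<exists>v. p = Node v then 1 else 0) + num_nodes D"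
  by (auto simp: num_nodes_def placed_def filter_map o_def case_prod_unfold)

lemma writhe_no_crossing:
  "(\<And>k. p k \<noteq> Pos \<and> p k \<noteq> Neg) \<Longrightarrow> writhe (map (\<lambda>k. (f k, p k)) ks) = 0"
  by (induction ks) auto

lemma writhe_braid_word [simp]: "writhe (braid_word ks) = int (length ks)"
  by (induction ks) auto

text \<open>Resolving a vertex creates no crossing, so the writhe correction in
  \<open>singular_bracket\<close> can be compared with a grading on webs.\<close>

lemma writhe_web_of [simp]: "writhe (web_of n D) = writhe D"
proof (induction D)
  case (Cons a D)
  obtain i p where "a = (i, p)" by (cases a)
  moreover have "writhe (resolved_vertex n) = 0"
    by (simp add: resolved_vertex_def writhe_no_crossing)
  ultimately show ?case using Cons by (cases p) simp_all
qed simp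

section \<open>Reduced words and antisymmetrizers\<close>

text \<open>The permutation of the descending run \<open>rev [c..<k]\<close>. For
  \<open>c \<le> k\<close> these are the shortest representatives of the left cosets of the
  symmetric group on \<open>{..<k}\<close> in that on \<open>{..<Suc k}\<close>;
  \<open>unrot\<close> is the inverse.\<close>

definition rot :: "nat \<Rightarrow> nat \<Rightarrow> nat \<Rightarrow> nat" where
  "rot c k m = (if m = k then c else if c \<le> m \<and> m < k then Suc m else m)"

definition unrot :: "nat \<Rightarrow> nat \<Rightarrow> nat \<Rightarrow> nat" where
  "unrot c k m = (if m = c then k else if c < m \<and> m \<le> k then m - 1 else m)"

lemma unrot_rot [simp]: "c \<le> k \<Longrightarrow> unrot c k (rot c k m) = m"
  by (auto simp: rot_def unrot_def)

lemma rot_unrot [simp]: "c \<le> k \<Longrightarrow> rot c k (unrot c k m) = m"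
  by (auto simp: rot_def unrot_def)

lemma rot_permutes:
  assumes "c \<le> k"
  shows "rot c k permutes {..<Suc k}"
proof (rule bij_imp_permutes)
  show "bij_betw (rot c k) {..<Suc k} {..<Suc k}"
    using assms by (intro bij_betwI[where g = "unrot c k"]) (auto simp: rot_def unrot_def)
qed (use assms in \<open>auto simp: rot_def\<close>)

lemma unrot_permutes:
  assumes "c \<le> k"
  shows "unrot c k permutes {..<Suc k}"
proof (rule bij_imp_permutes)
  show "bij_betw (unrot c k) {..<Suc k} {..<Suc k}"
    using assms by (intro bij_betwI[where g = "rot c k"]) (auto simp: rot_def unrot_def)
qed (use assms in \<open>auto simp: unrot_def\<close>)

lemma fold_transpose_rot:
  "c \<le> k \<Longrightarrow> fold (\<lambda>k. transpose k (Suc k)) (rev [c..<k]) m = rot c k m"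
proof (induction k arbitrary: m)
  case (Suc k)
  show ?case
  proof (cases "c = Suc k")
    case False
    with Suc show ?thesis by (auto simp: transpose_def rot_def)
  qed (auto simp: rot_def)
qed (auto simp: rot_def)

text \<open>The coset representative determined by the image of \<open>k\<close> is split off; the
  remaining permutation fixes \<open>k\<close>. The letters act from left to right, so the
  representative comes last.\<close>

fun reduced_word :: "nat \<Rightarrow> (nat \<Rightarrow> nat) \<Rightarrow> nat list" where
  "reduced_word 0 \<sigma> = []"
| "reduced_word (Suc k) \<sigma> = reduced_word k (unrot (\<sigma> k) k \<circ> \<sigma>) @ rev [\<sigma> k..<k]"

lemma permutes_Suc_decompose:
  assumes "\<sigma> permutes {..<Suc k}"
  shows "\<sigma> k \<le> k" "unrot (\<sigma> k) k \<circ> \<sigma> permutes {..<k}"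
proof -
  show le: "\<sigma> k \<le> k" using permutes_in_image[OF assms, of k] by simp
  have "unrot (\<sigma> k) k \<circ> \<sigma> permutes {..<Suc k}"
    using permutes_compose[OF assms unrot_permutes[OF le]] .
  then show "unrot (\<sigma> k) k \<circ> \<sigma> permutes {..<k}"
    by (rule permutes_superset) (auto simp: unrot_def less_Suc_eq)
qed

lemma permutes_Suc_compose:
  assumes "\<tau> permutes {..<k}" "c \<le> k"
  shows "rot c k \<circ> \<tau> permutes {..<Suc k}" "(rot c k \<circ> \<tau>) k = c"
    "unrot c k \<circ> (rot c k \<circ> \<tau>) = \<tau>"
  using assms permutes_compose[OF permutes_subset[OF assms(1), of "{..<Suc k}"] rot_permutes[OF assms(2)]]
  by (auto simp: permutes_not_in rot_def[of c k k])

text \<open>\<open>rot c k\<close> preserves the order on \<open>{..<k}\<close>, so the inversions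
  of \<open>\<tau>\<close> survive. The new ones are the pairs \<open>(i, k)\<close> with
  \<open>c \<le> \<tau> i\<close>, and there are \<open>k - c\<close> of them because
  \<open>\<tau>\<close> is a bijection.\<close>

lemma inversions_rot:
  assumes "\<tau> permutes {..<k}" "c \<le> k"
  shows "inversions (Suc k) (rot c k \<circ> \<tau>) = inversions k \<tau> + (k - c)"
proof -
  let ?\<sigma> = "rot c k \<circ> \<tau>"
  let ?A = "{(i, j). i < j \<and> j < k \<and> \<tau> j < \<tau> i}" and ?B = "(\<lambda>i. (i, k)) ` {i. i < k \<and> c \<le> \<tau> i}"
  have lt: "\<tau> i < k" if "i < k" for i using permutes_in_image[OF assms(1), of i] that by simp
  have mono: "rot c k a < rot c k b \<longleftrightarrow> a < b" if "a < k" "b < k" for a b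
    using that by (auto simp: rot_def)
  have top: "c < rot c k a \<longleftrightarrow> c \<le> a" if "a < k" for a
    using that assms(2) by (auto simp: rot_def)
  have \<tau>k: "\<tau> k = k" using assms(1) by (simp add: permutes_not_in)
  have "{(i, j). i < j \<and> j < Suc k \<and> ?\<sigma> j < ?\<sigma> i} = ?A \<union> ?B"
  proof -
    have "i < j \<and> j < Suc k \<and> ?\<sigma> j < ?\<sigma> i \<longleftrightarrow>
        i < j \<and> j < k \<and> \<tau> j < \<tau> i \<or> j = k \<and> i < k \<and> c \<le> \<tau> i" for i j
    proof (cases "j = k")
      case True
      then show ?thesis using top[OF lt[of i]] \<tau>k by (auto simp: rot_def[of c k k])
    next
      case False
      then show ?thesis using mono[OF lt[of j] lt[of i]] by (auto simp: less_Suc_eq)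
    qed
    then show ?thesis by auto
  qed
  moreover have "?A \<inter> ?B = {}" by auto
  moreover have "finite ?A" by (rule finite_subset[of _ "{..<k} \<times> {..<k}"]) auto
  moreover have "card ?B = k - c"
  proof -
    have "{i. i < k \<and> c \<le> \<tau> i} = \<tau> -` {c..<k}"
    proof -
      have "i < k \<longleftrightarrow> \<tau> i < k" for i using permutes_in_image[OF assms(1), of i] by simp
      then show ?thesis unfolding vimage_def by (intro Collect_cong) (simp add: conj_commute)
    qed
    then have "card {i. i < k \<and> c \<le> \<tau> i} = k - c"
      using card_vimage_inj[OF permutes_inj[OF assms(1)], of "{c..<k}"] permutes_surj[OF assms(1)] by simp
    then show ?thesis by (simp add: card_image inj_on_def)
  qed
  ultimately show ?thesis by (simp add: inversions_def card_Un_disjoint)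
qed

lemma reduced_word_properties:
  assumes "\<sigma> permutes {..<n}"
  shows "\<forall>k \<in> set (reduced_word n \<sigma>). Suc k < n"
    "fold (\<lambda>k. transpose k (Suc k)) (reduced_word n \<sigma>) = \<sigma>"
    "length (reduced_word n \<sigma>) = inversions n \<sigma>"
proof -
  have "(\<forall>k \<in> set (reduced_word n \<sigma>). Suc k < n) \<and>
    fold (\<lambda>k. transpose k (Suc k)) (reduced_word n \<sigma>) = \<sigma> \<and>
    length (reduced_word n \<sigma>) = inversions n \<sigma>"
    using assms
  proof (induction n arbitrary: \<sigma>)
    case 0
    then show ?case by (simp add: inversions_def)
  next
    case (Suc n)
    let ?\<tau> = "unrot (\<sigma> n) n \<circ> \<sigma>"
    note d = permutes_Suc_decompose[OF Suc.prems]
    note IH = Suc.IH[OF d(2)]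
    have eq: "rot (\<sigma> n) n \<circ> ?\<tau> = \<sigma>" using d(1) by auto
    have f: "fold (\<lambda>k. transpose k (Suc k)) (rev [\<sigma> n..<n]) = rot (\<sigma> n) n"
      using fold_transpose_rot[OF d(1)] by (rule ext)
    have "fold (\<lambda>k. transpose k (Suc k)) (reduced_word (Suc n) \<sigma>) = \<sigma>"
      by (simp only: reduced_word.simps fold_append IH f eq)
    moreover have "length (reduced_word (Suc n) \<sigma>) = inversions (Suc n) \<sigma>"
      using inversions_rot[OF d(2,1)] IH unfolding eq by (simp add: comp_def)
    moreover have "Suc k < Suc n" if "k \<in> set (reduced_word (Suc n) \<sigma>)" for k
      using that IH by (auto simp: comp_def less_Suc_eq)
    ultimately show ?case by blast
  qed
  then show "\<forall>k \<in> set (reduced_word n \<sigma>). Suc k < n"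
    "fold (\<lambda>k. transpose k (Suc k)) (reduced_word n \<sigma>) = \<sigma>"
    "length (reduced_word n \<sigma>) = inversions n \<sigma>" by auto
qed

lemma positive_braid_reduced_word:
  "\<sigma> permutes {..<n} \<Longrightarrow> positive_braid n \<sigma> (braid_word (reduced_word n \<sigma>))"
  using reduced_word_properties[of \<sigma> n] unfolding positive_braid_def braid_word_def by blast

text \<open>A reduced word in \<open>S\<^sub>k\<^sub>+\<^sub>1\<close> is one in \<open>S\<^sub>k\<close> followed by a descending run from
  \<open>k - 1\<close>; summing over the runs first gives the recursion. With \<open>x = - q\<^sup>-\<^sup>1\<close> this is the
  \<open>q\<close>-antisymmetrizer of the Hecke algebra, evaluated by a functional \<open>F\<close> on braid words.\<close>

fun antisymmetrizer :: "'a :: comm_ring_1 \<Rightarrow> nat \<Rightarrow> (nat list \<Rightarrow> 'a) \<Rightarrow> nat list \<Rightarrow> 'a" where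
  "antisymmetrizer x 0 F t = F t"
| "antisymmetrizer x (Suc k) F t =
     (\<Sum>c\<le>k. x ^ (k - c) * antisymmetrizer x k F (rev [c..<k] @ t))"

text \<open>The coset decomposition is a bijection between permutations of \<open>{..<Suc k}\<close>
  and pairs of a value \<open>c \<le> k\<close> and a permutation of \<open>{..<k}\<close>.
  Additivity of length makes the weights multiply accordingly.\<close>

lemma sum_permutations_eq_antisymmetrizer:
  "(\<Sum>\<sigma> | \<sigma> permutes {..<k}. x ^ inversions k \<sigma> * F (reduced_word k \<sigma> @ t)) = antisymmetrizer x k F t"
proof (induction k arbitrary: t)
  case 0
  show ?case by (simp add: inversions_def)
next
  case (Suc k)
  let ?g = "\<lambda>k \<sigma> t. x ^ inversions k \<sigma> * F (reduced_word k \<sigma> @ t)"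
  have "(\<Sum>\<sigma> | \<sigma> permutes {..<Suc k}. ?g (Suc k) \<sigma> t)
      = (\<Sum>(c, \<tau>) \<in> {..k} \<times> {\<tau>. \<tau> permutes {..<k}}. x ^ (k - c) * ?g k \<tau> (rev [c..<k] @ t))"
  proof (rule sum.reindex_bij_witness[where i = "\<lambda>(c, \<tau>). rot c k \<circ> \<tau>" and j = "\<lambda>\<sigma>. (\<sigma> k, unrot (\<sigma> k) k \<circ> \<sigma>)"])
    fix \<sigma> assume "\<sigma> \<in> {\<sigma>. \<sigma> permutes {..<Suc k}}"
    then have p: "\<sigma> permutes {..<Suc k}" by simp
    note d = permutes_Suc_decompose[OF this]
    have eq: "rot (\<sigma> k) k \<circ> (unrot (\<sigma> k) k \<circ> \<sigma>) = \<sigma>" using d(1) by auto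
    then show "(case (\<sigma> k, unrot (\<sigma> k) k \<circ> \<sigma>) of (c, \<tau>) \<Rightarrow> rot c k \<circ> \<tau>) = \<sigma>" by simp
    show "(\<sigma> k, unrot (\<sigma> k) k \<circ> \<sigma>) \<in> {..k} \<times> {\<tau>. \<tau> permutes {..<k}}" using d by simp
    show "(case (\<sigma> k, unrot (\<sigma> k) k \<circ> \<sigma>) of (c, \<tau>) \<Rightarrow> x ^ (k - c) * ?g k \<tau> (rev [c..<k] @ t)) = ?g (Suc k) \<sigma> t"
      using inversions_rot[OF d(2,1)] unfolding eq by (simp add: power_add mult_ac)
  qed (use permutes_Suc_compose in \<open>auto simp: permutes_Suc_compose\<close>)
  also have "\<dots> = (\<Sum>c\<le>k. x ^ (k - c) * (\<Sum>\<tau> | \<tau> permutes {..<k}. ?g k \<tau> (rev [c..<k] @ t)))"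
    by (simp add: sum.cartesian_product sum_distrib_left)
  finally show ?case by (simp add: Suc.IH)
qed

text \<open>The expansion only puts words on \<open>k\<close> strands in front of the tail. An
  identity that holds after every such prefix therefore passes to the antisymmetrizer, even when
  functionals and tails differ from term to term.\<close>

lemma antisymmetrizer_linear:
  assumes "\<And>w. \<forall>a \<in> set w. Suc a < k \<Longrightarrow> F (w @ t) = c * G (w @ u) + d * H (w @ v)"
  shows "antisymmetrizer x k F t = c * antisymmetrizer x k G u + d * antisymmetrizer x k H v"
  using assms
proof (induction k arbitrary: t u v)
  case 0
  then show ?case using 0[of "[]"] by simp
next
  case (Suc k)
  have "antisymmetrizer x k F (rev [e..<k] @ t) =
      c * antisymmetrizer x k G (rev [e..<k] @ u) + d * antisymmetrizer x k H (rev [e..<k] @ v)" if "e \<le> k" for e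
  proof (rule Suc.IH)
    fix w assume "\<forall>a\<in>set w. Suc a < k"
    then show "F (w @ rev [e..<k] @ t) = c * G (w @ rev [e..<k] @ u) + d * H (w @ rev [e..<k] @ v)"
      using Suc.prems[of "w @ rev [e..<k]"] by fastforce
  qed
  then have "antisymmetrizer x (Suc k) F t = (\<Sum>e\<le>k. x ^ (k - e) *
      (c * antisymmetrizer x k G (rev [e..<k] @ u) + d * antisymmetrizer x k H (rev [e..<k] @ v)))"
    by simp
  then show ?case by (simp add: algebra_simps sum.distrib sum_distrib_left)
qed

lemma antisymmetrizer_cong:
  assumes "\<And>w. \<forall>a \<in> set w. Suc a < k \<Longrightarrow> F (w @ t) = c * G (w @ u)"
  shows "antisymmetrizer x k F t = c * antisymmetrizer x k G u"
  using antisymmetrizer_linear[of k F t c G u 0 G u x] assms by simp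

text \<open>\<open>F\<close> factors through the positive braid monoid on \<open>N\<close> strands.
  Only words with letters in range are considered, since only these give diagrams in a hole with
  \<open>N\<close> strands.\<close>

definition braid_invariant :: "nat \<Rightarrow> (nat list \<Rightarrow> 'a) \<Rightarrow> bool" where
  "braid_invariant N F \<longleftrightarrow> (\<forall>u v. (\<forall>a \<in> set (u @ v). Suc a < N) \<longrightarrow>
     (\<forall>a b. Suc a < b \<longrightarrow> Suc b < N \<longrightarrow> F (u @ [a, b] @ v) = F (u @ [b, a] @ v)) \<and>
     (\<forall>a. Suc (Suc a) < N \<longrightarrow> F (u @ [a, Suc a, a] @ v) = F (u @ [Suc a, a, Suc a] @ v)))"

lemma braid_invariantD:
  assumes "braid_invariant N F" "\<forall>a \<in> set (u @ v). Suc a < N"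
  shows "Suc a < b \<Longrightarrow> Suc b < N \<Longrightarrow> F (u @ [a, b] @ v) = F (u @ [b, a] @ v)"
    "Suc (Suc a) < N \<Longrightarrow> F (u @ [a, Suc a, a] @ v) = F (u @ [Suc a, a, Suc a] @ v)"
  using assms unfolding braid_invariant_def by blast+

lemma braid_invariant_commute:
  assumes "braid_invariant N F" "\<forall>a \<in> set (u @ w @ v). Suc a < N" "\<forall>b \<in> set w. Suc a < b \<or> Suc b < a" "Suc a < N"
  shows "F (u @ w @ a # v) = F (u @ a # w @ v)"
  using assms(2,3)
proof (induction w arbitrary: u)
  case (Cons b w)
  have "F (u @ (b # w) @ a # v) = F ((u @ [b]) @ w @ a # v)" by simp
  also have "\<dots> = F ((u @ [b]) @ a # w @ v)" using Cons.prems by (intro Cons.IH) auto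
  also have "\<dots> = F (u @ [b, a] @ w @ v)" by simp
  also have "\<dots> = F (u @ [a, b] @ w @ v)"
    using braid_invariantD(1)[OF assms(1), of u "w @ v" a b] braid_invariantD(1)[OF assms(1), of u "w @ v" b a]
      Cons.prems assms(4) by auto
  finally show ?case by simp
qed simp

text \<open>A letter behind a descending run moves to its front and drops by one: it commutes with
  the letters below \<open>i - 1\<close>, the braid relation turns \<open>i, i - 1, i\<close> into
  \<open>i - 1, i, i - 1\<close>, and the leading \<open>i - 1\<close> commutes with the letters
  above \<open>i\<close>.\<close>

lemma braid_invariant_slide:
  assumes F: "braid_invariant N F" and l: "\<forall>a \<in> set (u @ v). Suc a < N"
    and i: "c < i" "i < k" "k < N"
  shows "F (u @ rev [c..<k] @ i # v) = F (u @ (i - 1) # rev [c..<k] @ v)"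
proof -
  obtain j where j: "i = Suc j" using i by (cases i) auto
  have eq: "rev [c..<k] = rev [Suc i..<k] @ [i, j] @ rev [c..<j]"
    using i j upt_add_eq_append[of c j "k - j"] by (simp add: upt_conv_Cons)
  have "F (u @ rev [c..<k] @ i # v) = F ((u @ rev [Suc i..<k] @ [i, j]) @ rev [c..<j] @ i # v)"
    by (simp add: eq)
  also have "\<dots> = F ((u @ rev [Suc i..<k] @ [i, j]) @ i # rev [c..<j] @ v)"
    using l i j by (intro braid_invariant_commute[OF F]) auto
  also have "\<dots> = F ((u @ rev [Suc i..<k]) @ [Suc j, j, Suc j] @ rev [c..<j] @ v)"
    by (simp add: j)
  also have "\<dots> = F ((u @ rev [Suc i..<k]) @ [j, Suc j, j] @ rev [c..<j] @ v)"
    using l i j by (intro braid_invariantD(2)[OF F, symmetric]) auto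
  also have "\<dots> = F (u @ rev [Suc i..<k] @ j # [i, j] @ rev [c..<j] @ v)" by (simp add: j)
  also have "\<dots> = F (u @ j # rev [Suc i..<k] @ [i, j] @ rev [c..<j] @ v)"
    using l i j by (intro braid_invariant_commute[OF F]) auto
  also have "\<dots> = F (u @ (i - 1) # rev [c..<k] @ v)" by (simp add: eq j)
  finally show ?thesis .
qed

text \<open>\<open>F\<close> factors further through the Hecke algebra, in which each generator
  \<open>s\<close> satisfies \<open>s * s = z * s + 1\<close>.\<close>

definition hecke_invariant :: "nat \<Rightarrow> 'a :: comm_ring_1 \<Rightarrow> (nat list \<Rightarrow> 'a) \<Rightarrow> bool" where
  "hecke_invariant N z F \<longleftrightarrow> braid_invariant N F \<and>
     (\<forall>u v a. (\<forall>a \<in> set (u @ v). Suc a < N) \<longrightarrow> Suc a < N \<longrightarrow>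
        F (u @ [a, a] @ v) = z * F (u @ [a] @ v) + F (u @ v))"

lemma hecke_invariantD:
  assumes "hecke_invariant N z F" "\<forall>a \<in> set (u @ v). Suc a < N" "Suc a < N"
  shows "F (u @ [a, a] @ v) = z * F (u @ [a] @ v) + F (u @ v)"
  using assms unfolding hecke_invariant_def by blast

text \<open>Induction on \<open>k\<close>, splitting the sum over runs. For \<open>c\<close> other
  than \<open>i\<close> and \<open>Suc i\<close> the letter passes the run and is absorbed by the
  antisymmetrizer on \<open>k\<close> strands. The two remaining terms are matched by the quadratic
  relation, of which \<open>x\<close> is a root.\<close>

lemma antisymmetrizer_absorb:
  assumes F: "hecke_invariant N z F" and x: "x * z + 1 = x\<^sup>2"
    and "Suc i < k" "k \<le> N" "\<forall>a \<in> set t. Suc a < N"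
  shows "antisymmetrizer x k F (i # t) = x * antisymmetrizer x k F t"
  using assms(3-5)
proof (induction k arbitrary: i t)
  case (Suc k)
  have B: "braid_invariant N F" using F by (simp add: hecke_invariant_def)
  let ?A = "antisymmetrizer x k F"
  let ?f = "\<lambda>c t. x ^ (k - c) * ?A (rev [c..<k] @ t)"
  let ?R = "{..k} - {i, Suc i}"
  have split: "(\<Sum>c\<le>k. ?f c t) = (\<Sum>c\<in>?R. ?f c t) + (?f i t + ?f (Suc i) t)" for t
    using Suc.prems(1) sum.subset_diff[of "{i, Suc i}" "{..k}" "\<lambda>c. ?f c t"] by simp
  have "?f c (i # t) = x * ?f c t" if "c \<in> ?R" for c
  proof (cases "c < i")
    case True
    have "?A (rev [c..<k] @ i # t) = 1 * ?A ((i - 1) # rev [c..<k] @ t)"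
    proof (rule antisymmetrizer_cong)
      fix w assume "\<forall>a\<in>set w. Suc a < k"
      then have "\<forall>a \<in> set (w @ t). Suc a < N" using Suc.prems by auto
      from braid_invariant_slide[OF B this True, of k]
      show "F (w @ rev [c..<k] @ i # t) = 1 * F (w @ (i - 1) # rev [c..<k] @ t)"
        using Suc.prems by simp
    qed
    also have "\<dots> = x * ?A (rev [c..<k] @ t)"
      using True Suc.prems by (subst Suc.IH) auto
    finally show ?thesis by (simp add: mult_ac)
  next
    case False
    with that have c: "Suc i < c" "c \<le> k" by auto
    have "?A (rev [c..<k] @ i # t) = 1 * ?A (i # rev [c..<k] @ t)"
    proof (rule antisymmetrizer_cong)
      fix w assume "\<forall>a\<in>set w. Suc a < k"
      then have "\<forall>a \<in> set (w @ rev [c..<k] @ t). Suc a < N" using Suc.prems by auto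
      from braid_invariant_commute[OF B this, of i]
      show "F (w @ rev [c..<k] @ i # t) = 1 * F (w @ i # rev [c..<k] @ t)"
        using c Suc.prems by simp
    qed
    also have "\<dots> = x * ?A (rev [c..<k] @ t)"
      using c Suc.prems by (subst Suc.IH) auto
    finally show ?thesis by (simp add: mult_ac)
  qed
  then have rest: "(\<Sum>c\<in>?R. ?f c (i # t)) = x * (\<Sum>c\<in>?R. ?f c t)"
    by (simp add: sum_distrib_left)
  let ?D = "rev [Suc i..<k]"
  have D: "rev [i..<k] = ?D @ [i]" using Suc.prems by (simp add: upt_conv_Cons)
  obtain e where e: "k - Suc i = e" "k - i = Suc e" using Suc.prems by auto
  have "?A (?D @ [i] @ i # t) = z * ?A (?D @ [i] @ t) + 1 * ?A (?D @ t)"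
  proof (rule antisymmetrizer_linear)
    fix w assume "\<forall>a\<in>set w. Suc a < k"
    then have "\<forall>a\<in>set ((w @ ?D) @ t). Suc a < N" "Suc i < N" using Suc.prems by auto
    then show "F (w @ ?D @ [i] @ i # t) = z * F (w @ ?D @ [i] @ t) + 1 * F (w @ ?D @ t)"
      using hecke_invariantD[OF F, of "w @ ?D" t i] by simp
  qed
  \<comment> \<open>The run for \<open>c = i\<close> ends in the letter \<open>i\<close>, so
    appending \<open>i\<close> produces a square. Its linear part joins the term for
    \<open>c = Suc i\<close>, and \<open>x * z + 1\<close> collapses to the square of
    \<open>x\<close>.\<close>
  then have "?f i (i # t) + ?f (Suc i) (i # t) = x ^ e * (x * z + 1) * ?A (?D @ [i] @ t) + x ^ Suc e * ?A (?D @ t)"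
    by (simp add: D e algebra_simps)
  also have "\<dots> = x * (?f i t + ?f (Suc i) t)"
    unfolding x by (simp add: D e power2_eq_square algebra_simps)
  finally show ?case using rest split by (simp add: algebra_simps)
qed simp

section \<open>Braid words in web diagrams\<close>

text \<open>\<open>P\<close> and \<open>Q\<close> surround a disc through which \<open>N\<close> downward strands run, the leftmost of them
  at position \<open>i\<close>.\<close>

definition hole :: "nat \<Rightarrow> nat \<Rightarrow> nat \<Rightarrow> disc diagram \<Rightarrow> disc diagram \<Rightarrow> bool" where
  "hole n i N P Q \<longleftrightarrow> (\<exists>l r. length l = i \<and> tangle (disc_ends n) [] P (l @ replicate N Down @ r) \<and>
     tangle (disc_ends n) (l @ replicate N Down @ r) Q [])"

lemma hole_web_diagram:
  assumes "hole n i N P Q" "tangle (disc_ends n) (replicate N Down) A (replicate N Down)"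
  shows "web_diagram n (P @ placed i A @ Q)"
  using assms closed_placed unfolding hole_def web_diagram_def by blast

lemma tangle_slice:
  "length l = i \<Longrightarrow> tangle e (l @ top_of e p @ r) [(i, p)] (l @ bottom_of e p @ r)"
  by (auto simp: tangle_Cons_iff)

text \<open>A strand closed up on the right is moved into the surroundings. Braids on
  \<open>Suc N\<close> strands then fill the new hole, with their last strand closed.\<close>

lemma hole_close:
  assumes "hole n i N P Q"
  shows "hole n i (Suc N) (P @ [(i + N, Cap Down)]) ((i + N, Cup Down) # Q)"
proof -
  let ?e = "disc_ends n"
  from assms obtain l r where lr: "length l = i" "tangle ?e [] P (l @ replicate N Down @ r)"
     "tangle ?e (l @ replicate N Down @ r) Q []" unfolding hole_def by blast
  have "tangle ?e (l @ replicate N Down @ r) [(i + N, Cap Down)] (l @ replicate (Suc N) Down @ Up # r)"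
    using tangle_slice[of "l @ replicate N Down" "i + N" ?e "Cap Down" r] lr(1)
    by (simp add: replicate_app_Cons_same)
  moreover have "tangle ?e (l @ replicate (Suc N) Down @ Up # r) [(i + N, Cup Down)] (l @ replicate N Down @ r)"
    using tangle_slice[of "l @ replicate N Down" "i + N" ?e "Cup Down" r] lr(1)
    by (simp add: replicate_app_Cons_same)
  ultimately have "tangle ?e [] (P @ [(i + N, Cap Down)]) (l @ replicate (Suc N) Down @ Up # r)"
    "tangle ?e (l @ replicate (Suc N) Down @ Up # r) ([(i + N, Cup Down)] @ Q) []"
    using lr unfolding tangle_append_iff by blast+
  then show ?thesis using lr(1) unfolding hole_def by auto
qed

text \<open>Uniqueness stays outside the locale. It enters once, in the final theorem, to identify
  \<open>br\<close> with its homogeneous part.\<close>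

locale bracket =
  fixes n :: nat and br :: "disc diagram \<Rightarrow> rat fls"
  assumes n_ge_2: "n \<ge> 2" and bracket_axioms: "web_bracket_axioms n br"
begin

lemmas axiom_integral = bracket_axioms[unfolded web_bracket_axioms_def, THEN conjunct1, rule_format]
lemmas axiom_isotopy = bracket_axioms[unfolded web_bracket_axioms_def, THEN conjunct2, THEN conjunct1, rule_format]
lemmas axiom_skein = bracket_axioms[unfolded web_bracket_axioms_def, THEN conjunct2, THEN conjunct2, THEN conjunct1, rule_format]
lemmas axiom_curl = bracket_axioms[unfolded web_bracket_axioms_def, THEN conjunct2, THEN conjunct2, THEN conjunct2, THEN conjunct1, THEN spec, THEN spec, THEN spec, THEN bspec]
lemmas axiom_sink_source = bracket_axioms[unfolded web_bracket_axioms_def, THEN conjunct2, THEN conjunct2, THEN conjunct2, THEN conjunct2, THEN conjunct1, rule_format]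
lemmas axiom_circle = bracket_axioms[unfolded web_bracket_axioms_def, THEN conjunct2, THEN conjunct2, THEN conjunct2, THEN conjunct2, THEN conjunct2, THEN conjunct1, rule_format]
lemmas axiom_empty = bracket_axioms[unfolded web_bracket_axioms_def, THEN conjunct2, THEN conjunct2, THEN conjunct2, THEN conjunct2, THEN conjunct2, THEN conjunct2]

lemma integral: "web_diagram n D \<Longrightarrow> br D \<in> laurent_root_q"
  by (rule axiom_integral)

lemma isotopy_invariant:
  "web_diagram n D \<Longrightarrow> web_diagram n D' \<Longrightarrow> web_isotopic n D D' \<Longrightarrow> br D = br D'"
  by (rule axiom_isotopy)

lemma isotopy:
  assumes "web_move n A B" "web_diagram n (P @ placed i A @ Q)" "web_diagram n (P @ placed i B @ Q)"
  shows "br (P @ placed i A @ Q) = br (P @ placed i B @ Q)"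
proof -
  have "web_isotopic n (P @ placed i A @ Q) (P @ placed i B @ Q)"
    unfolding web_isotopic_def by (intro r_into_equivclp web_step.intros assms)
  with isotopy_invariant assms(2,3) show ?thesis by simp
qed

lemma skein:
  "web_diagram n (P @ placed i [(0, Pos)] @ Q) \<Longrightarrow>
     root_q * br (P @ placed i [(0, Pos)] @ Q) - inverse root_q * br (P @ placed i [(0, Neg)] @ Q)
       = (qvar n - inverse (qvar n)) * br (P @ Q)"
  by (rule axiom_skein)

lemma positive_curl:
  "c \<in> {curl_right, curl_left} \<Longrightarrow> web_diagram n (P @ placed i (c Pos) @ Q) \<Longrightarrow>
     br (P @ placed i (c Pos) @ Q) = root_q powi (int n * int n - 1) * br (P @ Q)"
  by (rule axiom_curl[THEN conjunct1, THEN mp])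

lemma negative_curl:
  "c \<in> {curl_right, curl_left} \<Longrightarrow> web_diagram n (P @ placed i (c Neg) @ Q) \<Longrightarrow>
     br (P @ placed i (c Neg) @ Q) = root_q powi (1 - int n * int n) * br (P @ Q)"
  by (rule axiom_curl[THEN conjunct2, THEN mp])

lemma sink_source:
  "web_diagram n (P @ placed i [(0, Node Sink), (0, Node Source)] @ Q) \<Longrightarrow>
     (\<And>\<sigma>. \<sigma> permutes {..<n} \<Longrightarrow> positive_braid n \<sigma> (b \<sigma>)) \<Longrightarrow>
     br (P @ placed i [(0, Node Sink), (0, Node Source)] @ Q)
       = qvar n ^ (n * (n - 1)) * (\<Sum>\<sigma> | \<sigma> permutes {..<n}.
           (- (root_q powi (1 - int n))) ^ inversions n \<sigma> * br (P @ placed i (b \<sigma>) @ Q))"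
  by (rule axiom_sink_source)

lemma trivial_circle:
  "web_diagram n (P @ placed i (circle d) @ Q) \<Longrightarrow> br (P @ placed i (circle d) @ Q) = qint n n * br (P @ Q)"
  by (rule axiom_circle)

lemma empty_diagram: "br [] = 1"
  by (rule axiom_empty)

text \<open>The letters of \<open>u\<close> and \<open>v\<close> are counted as surroundings, so a
  local move applies at strand \<open>a\<close> of the hole.\<close>

lemma word_move:
  assumes "hole n i N P Q" "web_move n A B" "placed a A = braid_word w" "placed a B = braid_word w'"
    and "\<forall>k \<in> set (u @ w @ w' @ v). Suc k < N"
  shows "br (P @ placed i (braid_word (u @ w @ v)) @ Q) = br (P @ placed i (braid_word (u @ w' @ v)) @ Q)"
proof -
  have eq: "P @ placed i (braid_word (u @ w @ v)) @ Q
      = (P @ placed i (braid_word u)) @ placed (i + a) A @ (placed i (braid_word v) @ Q)"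
    "P @ placed i (braid_word (u @ w' @ v)) @ Q
      = (P @ placed i (braid_word u)) @ placed (i + a) B @ (placed i (braid_word v) @ Q)"
    by (simp_all add: placed_simps(4)[symmetric] assms(3,4) del: placed_simps(4))
  have "web_diagram n (P @ placed i (braid_word (u @ w @ v)) @ Q)"
    "web_diagram n (P @ placed i (braid_word (u @ w' @ v)) @ Q)"
    using assms(5) by (auto intro!: hole_web_diagram[OF assms(1)] tangle_braid_word simp del: braid_word_simps)
  then show ?thesis using isotopy[OF assms(2)] unfolding eq by blast
qed

text \<open>With this factor per crossing the skein relation becomes the quadratic Hecke relation.\<close>

definition weighted :: "nat \<Rightarrow> disc diagram \<Rightarrow> disc diagram \<Rightarrow> nat list \<Rightarrow> rat fls" where
  "weighted i P Q w = root_q ^ length w * br (P @ placed i (braid_word w) @ Q)"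

text \<open>The skein relation is applied to the second of two equal crossings. Its negative version
  cancels against the first crossing by the second Reidemeister move, and its smoothing leaves a
  single crossing.\<close>

lemma weighted_square:
  assumes "hole n i N P Q" "\<forall>k \<in> set (u @ v). Suc k < N" "Suc a < N"
  shows "weighted i P Q (u @ [a, a] @ v)
    = (qvar n - inverse (qvar n)) * weighted i P Q (u @ [a] @ v) + weighted i P Q (u @ v)"
proof -
  let ?P = "P @ placed i (braid_word u)" and ?Q = "placed i (braid_word v) @ Q"
  have d: "web_diagram n (P @ placed i (braid_word (u @ [a, a] @ v)) @ Q)"
    "web_diagram n (P @ placed i (braid_word (u @ v)) @ Q)"
    using assms by (auto intro!: hole_web_diagram[OF assms(1)] tangle_braid_word simp del: braid_word_simps)
  have "tangle (disc_ends n) (replicate N Down) (braid_word (u @ [a]) @ [(a, Neg)] @ braid_word v) (replicate N Down)"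
    using assms(2,3) tangle_braid_word[of "u @ [a]" N] tangle_braid_word[of v N] tangle_crossing[of a N Neg]
    unfolding tangle_append_iff[of _ _ "braid_word (u @ [a])"] tangle_append_iff[of _ _ "[(a, Neg)]"]
    by (intro exI[of _ "replicate N Down"] conjI) (auto simp del: braid_word_simps)
  from hole_web_diagram[OF assms(1) this]
  have "br (?P @ placed (i + a) [(0, Pos), (0, Neg)] @ ?Q) = br (?P @ placed (i + a) [] @ ?Q)"
    using d by (intro isotopy web_move.cancel) auto
  then have "br ((?P @ [(i + a, Pos)]) @ placed (i + a) [(0, Neg)] @ ?Q) = br (P @ placed i (braid_word (u @ v)) @ Q)"
    by simp
  moreover have "root_q * br (P @ placed i (braid_word (u @ [a, a] @ v)) @ Q)
      - inverse root_q * br ((?P @ [(i + a, Pos)]) @ placed (i + a) [(0, Neg)] @ ?Q)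
      = (qvar n - inverse (qvar n)) * br (P @ placed i (braid_word (u @ [a] @ v)) @ Q)"
    using skein[of "?P @ [(i + a, Pos)]" "i + a" ?Q] d by simp
  ultimately have e: "root_q * br (P @ placed i (braid_word (u @ [a, a] @ v)) @ Q)
      = (qvar n - inverse (qvar n)) * br (P @ placed i (braid_word (u @ [a] @ v)) @ Q)
        + inverse root_q * br (P @ placed i (braid_word (u @ v)) @ Q)"
    by (simp add: diff_eq_eq)
  \<comment> \<open>Multiplication by \<open>s ^ Suc L\<close> distributes the weights over words
    with two, one and no additional letters; \<open>s\<close> stands for
    \<open>root_q\<close>.\<close>
  have "s ^ Suc (Suc L) * x = z * (s ^ Suc L * y) + s ^ L * w"
    if "s \<noteq> 0" "s * x = z * y + inverse s * w" for s x y z w :: "rat fls" and L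
  proof -
    have "s ^ Suc (Suc L) * x = s ^ Suc L * (s * x)" by (simp add: mult_ac)
    also have "\<dots> = z * (s ^ Suc L * y) + s ^ L * w"
      using that(1) unfolding that(2) by (simp add: field_simps)
    finally show ?thesis .
  qed
  from this[OF _ e, of "length (u @ v)"] show ?thesis by (simp add: weighted_def)
qed

text \<open>Both braid relations preserve the length of a word and hence its weight, so they follow
  from the exchange move and the third Reidemeister move.\<close>

lemma weighted_hecke:
  assumes "hole n i N P Q"
  shows "hecke_invariant N (qvar n - inverse (qvar n)) (weighted i P Q)"
proof -
  have "weighted i P Q (u @ [a, b] @ v) = weighted i P Q (u @ [b, a] @ v)"
    if l: "\<forall>k \<in> set (u @ v). Suc k < N" "Suc a < b" "Suc b < N" for u v a b
  proof -
    \<comment> \<open>The exchange move measures the gap from the right end of the first crossing,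
      which occupies two strands.\<close>
    obtain m where b: "b = a + (2 + m)" using l(2) less_natE[of "Suc a" b] by (metis add_2_eq_Suc add_Suc add_Suc_right)
    have "web_move n [(0, Pos), (2 + m, Pos)] [(2 + m, Pos), (0, Pos)]"
      using web_move.exchange[of n Pos m Pos] by simp
    from word_move[OF assms this, of a "[a, b]" "[b, a]" u v] l b
    show ?thesis by (simp add: weighted_def)
  qed
  moreover have "weighted i P Q (u @ [a, Suc a, a] @ v) = weighted i P Q (u @ [Suc a, a, Suc a] @ v)"
    if "\<forall>k \<in> set (u @ v). Suc k < N" "Suc (Suc a) < N" for u v a
    using word_move[OF assms web_move.braid, of a "[a, Suc a, a]" "[Suc a, a, Suc a]" u v] that
    by (simp add: weighted_def)
  ultimately show ?thesis using weighted_square[OF assms]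
    unfolding hecke_invariant_def braid_invariant_def by blast
qed

text \<open>A slice to the right of a braid slides past it one crossing at a time. Its position
  stays \<open>i + N\<close> because crossings do not change the number of strands.\<close>

lemma exchange_word:
  assumes "tangle (disc_ends n) [] P (l @ replicate N Down @ top_of (disc_ends n) h @ r)"
    "tangle (disc_ends n) (l @ replicate N Down @ bottom_of (disc_ends n) h @ r) R []"
    "\<forall>k \<in> set w. Suc k < N" "length l = i"
  shows "br (P @ placed i (braid_word w) @ (i + N, h) # R) = br (P @ (i + N, h) # placed i (braid_word w) @ R)"
  using assms(1,3)
proof (induction w arbitrary: P)
  case (Cons k w)
  let ?e = "disc_ends n" and ?D = "replicate N Down"
  obtain m where m: "N = k + (2 + m)"
    using Cons.prems(2) less_natE[of "Suc k" N] by (metis add_2_eq_Suc add_Suc add_Suc_right list.set_intros(1))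
  have word: "tangle ?e (l @ ?D @ s) (placed i (braid_word w')) (l @ ?D @ s)"
    if "\<forall>k \<in> set w'. Suc k < N" for w' s
    using tangle_placed[OF tangle_braid_word[OF that]] assms(4) by blast
  have h: "tangle ?e (l @ ?D @ top_of ?e h @ r) [(i + N, h)] (l @ ?D @ bottom_of ?e h @ r)"
    using tangle_slice[of "l @ ?D" "i + N" ?e h r] assms(4) by simp
  have k: "tangle ?e (l @ ?D @ s) [(i + k, Pos)] (l @ ?D @ s)" for s
    using word[of "[k]" s] Cons.prems by simp
  have "br (P @ placed i (braid_word (k # w)) @ (i + N, h) # R)
      = br ((P @ [(i + k, Pos)]) @ placed i (braid_word w) @ (i + N, h) # R)" by simp
  also have "\<dots> = br ((P @ [(i + k, Pos)]) @ (i + N, h) # placed i (braid_word w) @ R)"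
  proof (rule Cons.IH)
    show "tangle ?e [] (P @ [(i + k, Pos)]) (l @ ?D @ top_of ?e h @ r)"
      using Cons.prems(1) k unfolding tangle_append_iff by blast
  qed (use Cons.prems(2) in simp)
  also have "\<dots> = br (P @ placed (i + k) [(0, Pos), (2 + m, h)] @ (placed i (braid_word w) @ R))"
    by (simp add: m add.assoc)
  also have "\<dots> = br (P @ placed (i + k) [(2 + m, h), (0, Pos)] @ (placed i (braid_word w) @ R))"
  proof (rule isotopy)
    show "web_move n [(0, Pos), (2 + m, h)] [(2 + m, h), (0, Pos)]"
      using web_move.exchange[of n Pos m h] by simp
    have rest: "tangle ?e (l @ ?D @ bottom_of ?e h @ r) (placed i (braid_word w) @ R) []"
      using word[of w] Cons.prems assms(2) unfolding tangle_append_iff by auto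
    have "web_diagram n (P @ ([(i + k, Pos)] @ [(i + N, h)]) @ (placed i (braid_word w) @ R))"
      "web_diagram n (P @ ([(i + N, h)] @ [(i + k, Pos)]) @ (placed i (braid_word w) @ R))"
      unfolding web_diagram_def closed_diagram_def
        tangle_append_iff[of _ _ P] tangle_append_iff[of _ _ "[_] @ [_]"] tangle_append_iff[of _ _ "[_]" "[_]"]
      using h k rest Cons.prems by blast+
    then show "web_diagram n (P @ placed (i + k) [(0, Pos), (2 + m, h)] @ placed i (braid_word w) @ R)"
      "web_diagram n (P @ placed (i + k) [(2 + m, h), (0, Pos)] @ placed i (braid_word w) @ R)"
      by (simp_all add: m add.assoc)
  qed
  also have "\<dots> = br (P @ (i + N, h) # placed i (braid_word (k # w)) @ R)"
    by (simp add: m add.assoc)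
  finally show ?case .
qed simp

end

section \<open>Partial traces of the antisymmetrizer\<close>

lemma qvar_nonzero [simp]: "qvar n \<noteq> 0"
  by (simp add: qvar_def)

lemma qvar_minus_inverse_nonzero:
  assumes "n \<ge> 1"
  shows "qvar n - inverse (qvar n) \<noteq> 0"
proof
  assume "qvar n - inverse (qvar n) = 0"
  then have "qvar n * qvar n = 1" by (metis eq_iff_diff_eq_0 left_inverse qvar_nonzero)
  then have "root_q ^ (2 * n) = 1" by (simp add: qvar_def mult_2 power_add)
  from arg_cong[OF this, of "\<lambda>f. fls_nth f 0"] show False using assms by simp
qed

lemma qint_eq:
  "n \<ge> 1 \<Longrightarrow> (qvar n - inverse (qvar n)) * qint n k = qvar n ^ k - inverse (qvar n) ^ k"
  using qvar_minus_inverse_nonzero[of n]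
  by (simp add: qint_def power_int_minus power_inverse)

text \<open>Here \<open>qint n n\<close> comes from a free circle and the sum from the curls. After
  multiplication by \<open>q - inverse q\<close> the sum over the odd powers of
  \<open>- inverse q\<close> telescopes.\<close>

lemma qint_trace:
  assumes "n \<ge> 1" "m \<le> n"
  shows "qint n n + qvar n ^ n * (\<Sum>c<m. (- inverse (qvar n)) ^ (2 * (m - c) - 1))
    = inverse (qvar n) ^ m * qint n (n - m)"
proof -
  have gen: "(q - inverse q) * (\<Sum>c<m. (- inverse q) ^ (2 * (m - c) - 1)) = inverse q ^ (2 * m) - 1"
    if "q \<noteq> 0" for q :: "rat fls" and m
  proof (induction m)
    case (Suc m)
    have "(- inverse q) ^ (2 * Suc m - 1) = - (inverse q ^ (2 * m) * inverse q)"
      by (simp add: power_minus_odd mult_ac)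
    then have s: "(\<Sum>c<Suc m. (- inverse q) ^ (2 * (Suc m - c) - 1))
        = - (inverse q ^ (2 * m) * inverse q) + (\<Sum>c<m. (- inverse q) ^ (2 * (m - c) - 1))"
      by (simp add: sum.lessThan_Suc_shift del: sum.lessThan_Suc)
    have "(q - inverse q) * (\<Sum>c<Suc m. (- inverse q) ^ (2 * (Suc m - c) - 1))
        = (q - inverse q) * - (inverse q ^ (2 * m) * inverse q) + (inverse q ^ (2 * m) - 1)"
      by (simp only: s distrib_left Suc)
    also have "\<dots> = inverse q ^ (2 * Suc m) - 1"
      using that by (simp add: algebra_simps)
    finally show ?case .
  qed simp
  let ?q = "qvar n"
  have "q ^ n - inverse q ^ n + q ^ n * (inverse q ^ (2 * m) - 1) = inverse q ^ m * (q ^ (n - m) - inverse q ^ (n - m))"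
    if "q \<noteq> 0" for q :: "rat fls"
  proof -
    obtain e where e: "n = m + e" using assms(2) le_Suc_ex by blast
    have "q ^ m * inverse q ^ m = 1" using that by (simp flip: power_mult_distrib)
    moreover have "q ^ (m + e) * inverse q ^ (2 * m) = (q ^ m * inverse q ^ m) * (inverse q ^ m * q ^ e)"
      unfolding mult_2 power_add by (simp only: mult_ac)
    ultimately have "q ^ (m + e) * inverse q ^ (2 * m) = inverse q ^ m * q ^ e" by simp
    then have "q ^ (m + e) - inverse q ^ (m + e) + q ^ (m + e) * (inverse q ^ (2 * m) - 1)
        = inverse q ^ m * q ^ e - inverse q ^ m * inverse q ^ e"
      by (simp only: right_diff_distrib power_add[of "inverse q"]) simp
    then show ?thesis by (simp only: e right_diff_distrib add_diff_cancel_left')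
  qed
  from this[of ?q] have "(?q - inverse ?q) * (qint n n + ?q ^ n * (\<Sum>c<m. (- inverse ?q) ^ (2 * (m - c) - 1)))
      = (?q - inverse ?q) * (inverse ?q ^ m * qint n (n - m))"
    using gen[of ?q m] qint_eq[OF assms(1)]
    by (simp only: distrib_left mult.left_commute[of "?q - inverse ?q"] qvar_nonzero not_False_eq_True simp_thms)
  then show ?thesis using qvar_minus_inverse_nonzero[OF assms(1)] by simp
qed

lemma antisymmetrizer_absorb_word:
  assumes "hecke_invariant N z F" "x * z + 1 = x\<^sup>2" "k \<le> N" "\<forall>a \<in> set t. Suc a < k"
  shows "antisymmetrizer x k F t = x ^ length t * antisymmetrizer x k F []"
  using assms(4)
proof (induction t)
  case (Cons i t)
  then have "antisymmetrizer x k F (i # t) = x * antisymmetrizer x k F t"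
    using assms(3) by (intro antisymmetrizer_absorb[OF assms(1,2)]) auto
  with Cons show ?case by (simp add: mult.assoc)
qed simp

section \<open>Closing the strands of the antisymmetrizer\<close>

context bracket
begin

text \<open>The word does not involve the closed strand, so the cap slides down past it and meets
  the cup in a trivial circle.\<close>

lemma closed_strand_circle:
  assumes "hole n i m P Q" "\<forall>a \<in> set w. Suc a < m"
  shows "weighted i (P @ [(i + m, Cap Down)]) ((i + m, Cup Down) # Q) w = qint n n * weighted i P Q w"
proof -
  obtain l r where lr: "length l = i" "tangle (disc_ends n) [] P (l @ replicate m Down @ r)"
     "tangle (disc_ends n) (l @ replicate m Down @ r) Q []" using assms(1) unfolding hole_def by blast
  let ?W = "placed i (braid_word w)" and ?R = "(i + m, Cup Down) # Q"
  have R: "tangle (disc_ends n) (l @ replicate m Down @ bottom_of (disc_ends n) (Cap Down) @ r) ?R []"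
    using lr tangle.slice[of "disc_ends n" "l @ replicate m Down" "Cup Down" r Q "[]"] by simp
  have d: "web_diagram n ((P @ [(i + m, Cap Down)]) @ placed i (braid_word w) @ ?R)"
    using assms(2) by (intro hole_web_diagram[OF hole_close[OF assms(1)]] tangle_braid_word) auto
  have "br (P @ ?W @ (i + m, Cap Down) # ?R) = br (P @ (i + m, Cap Down) # ?W @ ?R)"
    using exchange_word[OF _ R assms(2) lr(1)] lr(2) by simp
  moreover have "br ((P @ ?W) @ placed (i + m) (circle Down) @ Q) = qint n n * br ((P @ ?W) @ Q)"
  proof (rule trivial_circle)
    have "tangle (disc_ends n) [] (P @ ?W) (l @ replicate m Down @ r)"
      using tangle_placed[OF tangle_braid_word[OF assms(2)]] lr(1,2) unfolding tangle_append_iff by blast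
    moreover have "tangle (disc_ends n) (l @ replicate m Down @ r) ([(i + m, Cap Down)] @ ?R) []"
      using tangle_slice[of "l @ replicate m Down" "i + m" "disc_ends n" "Cap Down" r] R lr(1)
      unfolding tangle_append_iff by auto
    ultimately show "web_diagram n ((P @ ?W) @ placed (i + m) (circle Down) @ Q)"
      unfolding web_diagram_def closed_diagram_def tangle_append_iff[of _ _ "P @ ?W"]
      by (auto simp: circle_def)
  qed
  ultimately show ?thesis by (simp add: weighted_def circle_def)
qed

text \<open>Only the letter \<open>m\<close> involves the closed strand. The cap slides below
  \<open>w\<close> and the cup above \<open>v\<close>, which leaves a positive curl on the last open
  strand. The weight \<open>root_q\<close> of the lost letter completes the curl factor to
  \<open>qvar n ^ n\<close>.\<close>

lemma closed_strand_curl: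
  assumes "hole n i (Suc m) P Q" "\<forall>a \<in> set (w @ v). Suc a < Suc m"
  shows "weighted i (P @ [(i + Suc m, Cap Down)]) ((i + Suc m, Cup Down) # Q) (w @ m # v)
    = qvar n ^ n * weighted i P Q (w @ v)"
proof -
  let ?D = "replicate (Suc m) Down" and ?e = "disc_ends n" and ?cap = "(i + Suc m, Cap Down)" and ?cup = "(i + Suc m, Cup Down)"
  obtain l r where lr: "length l = i" "tangle ?e [] P (l @ ?D @ r)"
     "tangle ?e (l @ ?D @ r) Q []" using assms(1) unfolding hole_def by blast
  let ?W = "placed i (braid_word w)" and ?V = "placed i (braid_word v)"
  have l: "\<forall>a \<in> set w. Suc a < Suc m" "\<forall>a \<in> set v. Suc a < Suc m" using assms(2) by auto
  have word: "tangle ?e (l @ ?D @ s) (placed i (braid_word w')) (l @ ?D @ s)"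
    if "\<forall>k \<in> set w'. Suc k < Suc m" for w' s
    using tangle_placed[OF tangle_braid_word[OF that]] lr(1) by blast
  have D: "?D = replicate m Down @ [Down]" by (simp add: replicate_append_same)
  have X: "tangle ?e (l @ ?D @ Down # Up # r) [(i + m, Pos)] (l @ ?D @ Down # Up # r)"
    using tangle_slice[of "l @ replicate m Down" "i + m" ?e Pos "Up # r"] lr(1) unfolding D by simp
  have cap: "tangle ?e (l @ ?D @ r) [?cap] (l @ ?D @ Down # Up # r)"
    using tangle_slice[of "l @ ?D" "i + Suc m" ?e "Cap Down" r] lr(1) by simp
  have cup: "tangle ?e (l @ ?D @ Down # Up # r) [?cup] (l @ ?D @ r)"
    using tangle_slice[of "l @ ?D" "i + Suc m" ?e "Cup Down" r] lr(1) by simp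
  have R: "tangle ?e (l @ ?D @ Down # Up # r) ([(i + m, Pos)] @ ?V @ [?cup] @ Q) []"
    using X word[OF l(2)] cup lr(3) unfolding tangle_append_iff by blast
  have "br (P @ ?cap # ?W @ [(i + m, Pos)] @ ?V @ [?cup] @ Q) = br (P @ ?W @ ?cap # [(i + m, Pos)] @ ?V @ [?cup] @ Q)"
    using exchange_word[of P l "Suc m" "Cap Down" r "[(i + m, Pos)] @ ?V @ [?cup] @ Q" w i] R lr l by simp
  also have "\<dots> = br ((P @ ?W @ ?cap # [(i + m, Pos)]) @ ?V @ ?cup # Q)" by simp
  also have "\<dots> = br ((P @ ?W @ ?cap # [(i + m, Pos)]) @ ?cup # ?V @ Q)"
  proof (rule exchange_word[of _ l _ _ r])
    have "tangle ?e [] (P @ ?W @ [?cap] @ [(i + m, Pos)]) (l @ ?D @ Down # Up # r)"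
      using X word[OF l(1)] cap lr(2) unfolding tangle_append_iff by blast
    then show "tangle ?e [] (P @ ?W @ ?cap # [(i + m, Pos)]) (l @ ?D @ top_of ?e (Cup Down) @ r)" by simp
  qed (use lr l in simp_all)
  also have "\<dots> = br ((P @ ?W) @ placed (i + m) (curl_right Pos) @ (?V @ Q))"
    by (simp add: curl_right_def)
  also have "\<dots> = root_q powi (int n * int n - 1) * br ((P @ ?W) @ ?V @ Q)"
  proof (rule positive_curl)
    have "tangle ?e [] (P @ ?W @ ([?cap] @ [(i + m, Pos)] @ [?cup]) @ ?V @ Q) []"
      using X word[OF l(1)] word[OF l(2)] cap cup lr(2,3) unfolding tangle_append_iff by blast
    then show "web_diagram n ((P @ ?W) @ placed (i + m) (curl_right Pos) @ (?V @ Q))"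
      by (simp add: curl_right_def web_diagram_def closed_diagram_def)
  qed simp
  finally have "br ((P @ [?cap]) @ placed i (braid_word (w @ m # v)) @ ?cup # Q)
      = root_q powi (int n * int n - 1) * br (P @ placed i (braid_word (w @ v)) @ Q)"
    by simp
  moreover have "root_q * root_q powi (int n * int n - 1) = qvar n ^ n"
  proof -
    have "s * s powi (int n * int n - 1) = (s ^ n) ^ n" if "s \<noteq> 0" for s :: "rat fls"
    proof -
      have "s powi (int n * int n - 1) = s ^ (n * n) / s"
        using that by (simp add: power_int_diff flip: of_nat_mult)
      then show ?thesis using that by (simp add: power_mult)
    qed
    from this[OF fls_X_nonzero] show ?thesis by (simp only: qvar_def)
  qed
  ultimately show ?thesis
    by (simp add: weighted_def mult.assoc mult.left_commute[of root_q] flip: mult.assoc)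
qed

abbreviation "qantisym \<equiv> antisymmetrizer (- inverse (qvar n))"

text \<open>The quadratic Hecke relation has the roots \<open>q\<close> and
  \<open>- inverse q\<close>; the latter belongs to the sign-like character.\<close>

lemma hecke_parameter:
  "- inverse (qvar n) * (qvar n - inverse (qvar n)) + 1 = (- inverse (qvar n))\<^sup>2"
proof -
  have "- inverse q * (q - inverse q) + 1 = (- inverse q)\<^sup>2" if "q \<noteq> 0" for q :: "rat fls"
    using that by (simp add: power2_eq_square algebra_simps)
  then show ?thesis by simp
qed

text \<open>The empty run contributes a circle. Any other run begins with the only letter that
  touches the closed strand; this becomes a curl, and the rest of the run is absorbed by the
  antisymmetrizer. What remains is the scalar of \<open>qint_trace\<close>.\<close>

lemma partial_trace:
  assumes "hole n i m P Q" "m \<le> n"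
  shows "qantisym (Suc m) (weighted i (P @ [(i + m, Cap Down)]) ((i + m, Cup Down) # Q)) []
    = inverse (qvar n) ^ m * qint n (n - m) * qantisym m (weighted i P Q) []"
proof -
  let ?x = "- inverse (qvar n)" and ?F = "weighted i P Q"
  let ?G = "weighted i (P @ [(i + m, Cap Down)]) ((i + m, Cup Down) # Q)"
  have circle: "qantisym m ?G [] = qint n n * qantisym m ?F []"
    by (rule antisymmetrizer_cong) (use closed_strand_circle[OF assms(1)] in simp)
  have curl: "?x ^ (m - c) * qantisym m ?G (rev [c..<m]) = qvar n ^ n * ?x ^ (2 * (m - c) - 1) * qantisym m ?F []"
    if "c < m" for c
  proof -
    \<comment> \<open>\<open>m'\<close> is the first letter of the run, the one crossing with the
      closed strand; \<open>rev [c..<m']\<close> is the part left after removing the curl.\<close>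
    obtain m' where m: "m = Suc m'" using \<open>c < m\<close> by (cases m) auto
    have rev: "rev [c..<m] = m' # rev [c..<m']" using that m by simp
    have "qantisym m ?G (rev [c..<m]) = qvar n ^ n * qantisym m ?F (rev [c..<m'])"
    proof (rule antisymmetrizer_cong)
      fix w assume "\<forall>a \<in> set w. Suc a < m"
      then have "\<forall>a \<in> set (w @ rev [c..<m']). Suc a < Suc m'" using m by auto
      from closed_strand_curl[OF assms(1)[unfolded m] this]
      show "?G (w @ rev [c..<m]) = qvar n ^ n * ?F (w @ rev [c..<m'])"
        unfolding rev by (simp only: m)
    qed
    also have "qantisym m ?F (rev [c..<m']) = ?x ^ (m - c - 1) * qantisym m ?F []"
      using antisymmetrizer_absorb_word[OF weighted_hecke[OF assms(1)] hecke_parameter, of m "rev [c..<m']"] m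
      by simp
    finally have "?x ^ (m - c) * qantisym m ?G (rev [c..<m]) = qvar n ^ n * (?x ^ (m - c) * ?x ^ (m - c - 1)) * qantisym m ?F []"
      by (simp only: mult_ac)
    also have "?x ^ (m - c) * ?x ^ (m - c - 1) = ?x ^ (2 * (m - c) - 1)"
    proof -
      have "m - c + (m - c - 1) = 2 * (m - c) - 1" using that by simp
      then show ?thesis by (metis power_add)
    qed
    finally show ?thesis .
  qed
  have "qantisym (Suc m) ?G [] = (\<Sum>c<m. ?x ^ (m - c) * qantisym m ?G (rev [c..<m])) + qantisym m ?G []"
    by (simp add: lessThan_Suc_atMost[symmetric])
  also have "\<dots> = (\<Sum>c<m. qvar n ^ n * ?x ^ (2 * (m - c) - 1) * qantisym m ?F []) + qint n n * qantisym m ?F []"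
    using curl circle by simp
  also have "\<dots> = (qint n n + qvar n ^ n * (\<Sum>c<m. ?x ^ (2 * (m - c) - 1))) * qantisym m ?F []"
    by (simp only: sum_distrib_left sum_distrib_right distrib_right add.commute)
  also have "\<dots> = inverse (qvar n) ^ m * qint n (n - m) * qantisym m ?F []"
    using qint_trace[of n m] n_ge_2 assms(2) by simp
  finally show ?thesis .
qed

text \<open>Closures are performed from the inner hole outwards. The hole itself belongs to the
  claim because each further closure requires it.\<close>

lemma full_trace:
  assumes "hole n i 2 P Q" "2 + j \<le> n"
  defines "P' \<equiv> P @ placed i (map (\<lambda>k. (2 + k, Cap Down)) [0..<j])"
    and "Q' \<equiv> placed i (map (\<lambda>k. (2 + k, Cup Down)) (rev [0..<j])) @ Q"
  shows "hole n i (2 + j) P' Q' \<and> qantisym (2 + j) (weighted i P' Q') []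
    = (\<Prod>k<j. inverse (qvar n) ^ (2 + k) * qint n (n - 2 - k)) * qantisym 2 (weighted i P Q) []"
  using assms(2) unfolding P'_def Q'_def
proof (induction j)
  case 0
  then show ?case using assms(1) by simp
next
  case (Suc j)
  let ?P = "P @ placed i (map (\<lambda>k. (2 + k, Cap Down)) [0..<j])"
    and ?Q = "placed i (map (\<lambda>k. (2 + k, Cup Down)) (rev [0..<j])) @ Q"
  have IH: "hole n i (2 + j) ?P ?Q"
    "qantisym (2 + j) (weighted i ?P ?Q) []
      = (\<Prod>k<j. inverse (qvar n) ^ (2 + k) * qint n (n - 2 - k)) * qantisym 2 (weighted i P Q) []"
    using Suc.IH Suc.prems by auto
  have eq: "P @ placed i (map (\<lambda>k. (2 + k, Cap Down)) [0..<Suc j]) = ?P @ [(i + (2 + j), Cap Down)]"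
    "placed i (map (\<lambda>k. (2 + k, Cup Down)) (rev [0..<Suc j])) @ Q = (i + (2 + j), Cup Down) # ?Q"
    "2 + Suc j = Suc (2 + j)"
    by simp_all
  have "qantisym (Suc (2 + j)) (weighted i (?P @ [(i + (2 + j), Cap Down)]) ((i + (2 + j), Cup Down) # ?Q)) []
      = inverse (qvar n) ^ (2 + j) * qint n (n - 2 - j) * qantisym (2 + j) (weighted i ?P ?Q) []"
    using partial_trace[OF IH(1)] Suc.prems by (simp add: diff_diff_left)
  then show ?case using hole_close[OF IH(1)] unfolding eq IH(2) by (simp add: mult_ac)
qed

lemma trace_coefficient:
  "qvar n ^ (n * (n - 1)) * (\<Prod>k<n - 2. inverse (qvar n) ^ (2 + k) * qint n (n - 2 - k))
    = qfact n (n - 2) * qvar n ^ (n * (n - 1) div 2) * qvar n"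
proof -
  obtain m where m: "n = m + 2" using n_ge_2 le_Suc_ex by (metis add.commute)
  \<comment> \<open>The exponents \<open>2 + k\<close> for \<open>k < m\<close> add up to
    \<open>m * (m + 3) div 2\<close>. For \<open>m = n - 2\<close> this is one less than
    \<open>n * (n - 1) div 2\<close>, whence the single surviving factor \<open>q\<close>.\<close>
  have powers: "q ^ Suc (m * (m + 3) div 2) * (\<Prod>k<m. inverse q ^ (2 + k)) = q" if "q \<noteq> 0" for q :: "rat fls" and m
  proof (induction m)
    case (Suc m)
    have e: "Suc m * (Suc m + 3) div 2 = m * (m + 3) div 2 + (2 + m)"
    proof -
      have "Suc m * (Suc m + 3) = m * (m + 3) + 2 * (2 + m)" by (simp add: algebra_simps)
      then show ?thesis by simp
    qed
    have "q ^ Suc (Suc m * (Suc m + 3) div 2) * (\<Prod>k<Suc m. inverse q ^ (2 + k))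
        = (q ^ Suc (m * (m + 3) div 2) * (\<Prod>k<m. inverse q ^ (2 + k))) * (q ^ (2 + m) * inverse q ^ (2 + m))"
      unfolding e by (simp only: prod.lessThan_Suc power_add power_Suc mult_ac)
    also have "q ^ (2 + m) * inverse q ^ (2 + m) = 1"
      by (simp only: power_mult_distrib[symmetric] right_inverse[OF that] power_one)
    finally show ?case unfolding Suc by simp
  qed simp
  define T where "T = n * (n - 1) div 2"
  have "n * (n - 1) = m * (m + 3) + 2" by (simp add: m algebra_simps)
  then have "Suc (m * (m + 3) div 2) = T" by (simp add: T_def)
  with powers[of "qvar n" "n - 2"] have I: "qvar n ^ T * (\<Prod>k<n - 2. inverse (qvar n) ^ (2 + k)) = qvar n"
    by (simp add: m)
  have F: "qfact n (n - 2) = (\<Prod>k<n - 2. qint n (n - 2 - k))"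
  proof -
    have "qfact n (n - 2) = (\<Prod>k<n - 2. qint n (Suc k))"
      unfolding qfact_def by (rule prod.reindex_bij_witness[of _ Suc "\<lambda>j. j - 1"]) auto
    also have "\<dots> = (\<Prod>k<n - 2. qint n (Suc (n - 2 - Suc k)))"
      by (rule prod.nat_diff_reindex[symmetric])
    also have "\<dots> = (\<Prod>k<n - 2. qint n (n - 2 - k))"
      by (rule prod.cong) (auto simp: Suc_diff_Suc)
    finally show ?thesis .
  qed
  have "even (n * (n - 1))" by (cases n) auto
  then have "n * (n - 1) = T + T" unfolding T_def by (metis dvd_mult_div_cancel mult_2)
  then have "qvar n ^ (n * (n - 1)) * (\<Prod>k<n - 2. inverse (qvar n) ^ (2 + k) * qint n (n - 2 - k))
      = qvar n ^ T * (qvar n ^ T * (\<Prod>k<n - 2. inverse (qvar n) ^ (2 + k))) * qfact n (n - 2)"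
    by (simp only: F power_add prod.distrib mult_ac)
  then show ?thesis unfolding I by (simp only: T_def mult_ac)
qed

text \<open>The caps and cups of the resolved vertex are counted as surroundings of its sink and
  source. Relation (3) then gives an antisymmetrizer on \<open>n\<close> strands with
  \<open>n - 2\<close> of them closed, and tracing these leaves the antisymmetrizer on two
  strands.\<close>

lemma resolved_vertex_bracket:
  assumes "hole n i 2 P Q"
  shows "br (P @ placed i (resolved_vertex n) @ Q)
    = qfact n (n - 2) * qvar n ^ (n * (n - 1) div 2)
      * (qvar n * br (P @ Q) - root_q * br (P @ placed i [(0, Pos)] @ Q))"
proof -
  define P' where "P' = P @ placed i (map (\<lambda>k. (2 + k, Cap Down)) [0..<n - 2])"
  define Q' where "Q' = placed i (map (\<lambda>k. (2 + k, Cup Down)) (rev [0..<n - 2])) @ Q"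
  let ?x = "- inverse (qvar n)"
  have n: "2 + (n - 2) = n" using n_ge_2 by simp
  from full_trace[OF assms, of "n - 2"]
  have h: "hole n i n P' Q'" and tr: "qantisym n (weighted i P' Q') []
      = (\<Prod>k<n - 2. inverse (qvar n) ^ (2 + k) * qint n (n - 2 - k)) * qantisym 2 (weighted i P Q) []"
    unfolding P'_def Q'_def n by simp_all
  \<comment> \<open>The coefficient per crossing splits into the Hecke parameter and the factor
    already contained in \<open>weighted\<close>.\<close>
  have x: "- (root_q powi (1 - int n)) = ?x * root_q"
  proof -
    have "- (s powi (1 - int n)) = - inverse (s ^ n) * s" if "s \<noteq> 0" for s :: "rat fls"
      using that by (simp add: power_int_diff divide_inverse mult.commute)
    from this[OF fls_X_nonzero] show ?thesis by (simp only: qvar_def)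
  qed
  have "br (P @ placed i (resolved_vertex n) @ Q) = br (P' @ placed i [(0, Node Sink), (0, Node Source)] @ Q')"
    by (simp add: P'_def Q'_def resolved_vertex_def)
  also have "\<dots> = qvar n ^ (n * (n - 1)) * (\<Sum>\<sigma> | \<sigma> permutes {..<n}.
      (- (root_q powi (1 - int n))) ^ inversions n \<sigma> * br (P' @ placed i (braid_word (reduced_word n \<sigma>)) @ Q'))"
  proof (rule sink_source)
    have "tangle (disc_ends n) (replicate n Down) [(0, Node Sink), (0, Node Source)] (replicate n Down)"
      by (auto simp: tangle_Cons_iff)
    then show "web_diagram n (P' @ placed i [(0, Node Sink), (0, Node Source)] @ Q')"
      by (rule hole_web_diagram[OF h])
  qed (rule positive_braid_reduced_word)
  also have "(\<Sum>\<sigma> | \<sigma> permutes {..<n}.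
      (- (root_q powi (1 - int n))) ^ inversions n \<sigma> * br (P' @ placed i (braid_word (reduced_word n \<sigma>)) @ Q'))
    = (\<Sum>\<sigma> | \<sigma> permutes {..<n}. ?x ^ inversions n \<sigma> * weighted i P' Q' (reduced_word n \<sigma> @ []))"
    unfolding x weighted_def
    by (intro sum.cong refl)
      (simp only: mem_Collect_eq reduced_word_properties(3) power_mult_distrib mult.assoc append_Nil2)
  also have "\<dots> = qantisym n (weighted i P' Q') []"
    by (rule sum_permutations_eq_antisymmetrizer)
  also have "qvar n ^ (n * (n - 1)) * \<dots>
      = qfact n (n - 2) * qvar n ^ (n * (n - 1) div 2) * (qvar n * qantisym 2 (weighted i P Q) [])"
    unfolding tr by (simp only: mult.assoc[symmetric] trace_coefficient)
  also have "qvar n * qantisym 2 (weighted i P Q) [] = qvar n * br (P @ Q) - root_q * br (P @ placed i [(0, Pos)] @ Q)"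
  proof -
    have "qantisym 2 (weighted i P Q) [] = weighted i P Q [] + ?x * weighted i P Q [0]"
      by (simp add: numeral_2_eq_2 atMost_Suc upt_conv_Cons)
    also have "qvar n * \<dots> = qvar n * weighted i P Q [] - weighted i P Q [0]"
    proof -
      have "q * (a + - inverse q * b) = q * a - b" if "q \<noteq> 0" for q a b :: "rat fls"
        using that by (simp add: algebra_simps)
      then show ?thesis by simp
    qed
    finally show ?thesis by (simp add: weighted_def)
  qed
  finally show ?thesis .
qed

end

section \<open>Homogeneity of the bracket\<close>

text \<open>The part of \<open>f\<close> in the degrees congruent to \<open>- w\<close> modulo \<open>n\<close>.\<close>

definition graded_part :: "nat \<Rightarrow> int \<Rightarrow> rat fls \<Rightarrow> rat fls" where
  "graded_part n w f = Abs_fls (\<lambda>k. if int n dvd k + w then fls_nth f k else 0)"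

lemma graded_part_nth [simp]:
  "fls_nth (graded_part n w f) k = (if int n dvd k + w then fls_nth f k else 0)"
  unfolding graded_part_def by (rule nth_Abs_fls_lower_bound[of "fls_subdegree f"]) simp

lemma graded_part_add: "graded_part n w (f + g) = graded_part n w f + graded_part n w g"
  by (rule fls_eqI) simp

lemma graded_part_diff: "graded_part n w (f - g) = graded_part n w f - graded_part n w g"
  by (rule fls_eqI) simp

lemma graded_part_uminus: "graded_part n w (- f) = - graded_part n w f"
  by (rule fls_eqI) simp

lemma graded_part_zero [simp]: "graded_part n w 0 = 0"
  by (rule fls_eqI) simp

lemma graded_part_one [simp]: "graded_part n 0 1 = 1"
  by (rule fls_eqI) simp

lemma graded_part_sum: "graded_part n w (\<Sum>x\<in>A. f x) = (\<Sum>x\<in>A. graded_part n w (f x))"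
  by (induction A rule: infinite_finite_induct) (simp_all add: graded_part_add)

lemma root_q_powi: "root_q powi k = fls_X_intpow k"
  by (simp add: fls_X_power_int)

lemma root_q_powi_times_nth: "fls_nth (root_q powi k * f) m = fls_nth f (m - k)"
  unfolding root_q_powi fls_X_intpow_times_conv_shift by simp

lemma graded_part_root_q_times:
  "graded_part n w (root_q powi k * f) = root_q powi k * graded_part n (w + k) f"
  by (rule fls_eqI) (simp only: graded_part_nth root_q_powi_times_nth, simp add: algebra_simps)

lemma graded_part_cong:
  assumes "int n dvd w - w'"
  shows "graded_part n w = graded_part n w'"
proof -
  have "int n dvd k + w \<longleftrightarrow> int n dvd k + w'" for k
    using assms dvd_add_left_iff[of "int n" "w - w'" "k + w'"] by (simp add: algebra_simps)
  then show ?thesis by (intro ext fls_eqI) simp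
qed

lemma qvar_eq_powi: "qvar n = root_q powi int n" "inverse (qvar n) = root_q powi (- int n)"
  by (simp_all only: qvar_def power_int_of_nat power_int_minus)

lemma qvar_power_eq_powi: "qvar n ^ k = root_q powi (int n * int k)"
  by (simp only: qvar_eq_powi power_int_mult power_int_of_nat)

lemma inverse_qvar_power_eq_powi: "inverse (qvar n) ^ k = root_q powi (- int n * int k)"
  by (simp only: qvar_eq_powi(2) power_int_mult power_int_of_nat)

text \<open>Powers of \<open>q\<close> have degree divisible by \<open>n\<close>, so they respect
  the grading modulo \<open>n\<close>.\<close>

lemma graded_part_qvar_times:
  "graded_part n w (qvar n ^ k * f) = qvar n ^ k * graded_part n w f"
  "graded_part n w (inverse (qvar n) ^ k * f) = inverse (qvar n) ^ k * graded_part n w f"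
  unfolding qvar_power_eq_powi inverse_qvar_power_eq_powi graded_part_root_q_times
  using graded_part_cong[of n "w + int n * int k" w] graded_part_cong[of n "w + - int n * int k" w] by simp_all

text \<open>\<open>qint\<close> is defined as a quotient, so the denominator
  \<open>q - inverse q\<close> is cleared first and cancelled at the end.\<close>

lemma graded_part_qint_times:
  assumes "n \<ge> 1"
  shows "graded_part n w (qint n k * f) = qint n k * graded_part n w f"
proof -
  let ?d = "qvar n - inverse (qvar n)"
  have d: "graded_part n w (?d * g) = ?d * graded_part n w g" for g
    using graded_part_qvar_times[of n w 1 g] by (simp add: left_diff_distrib graded_part_diff)
  have "?d * graded_part n w (qint n k * f) = graded_part n w ((?d * qint n k) * f)"
    by (simp only: d mult.assoc)
  also have "\<dots> = (?d * qint n k) * graded_part n w f"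
    unfolding qint_eq[OF assms] by (simp only: left_diff_distrib graded_part_diff graded_part_qvar_times)
  finally show ?thesis using qvar_minus_inverse_nonzero[OF assms] by (simp only: mult.assoc mult_cancel_left simp_thms)
qed

lemma graded_part_laurent: "f \<in> laurent_root_q \<Longrightarrow> graded_part n w f \<in> laurent_root_q"
  unfolding laurent_root_q_def by (auto intro: rev_finite_subset)

text \<open>Passing a strand across a disc removes or adds \<open>n\<close> crossings of one sign.
  All other moves preserve the writhe exactly.\<close>

lemma writhe_web_move:
  assumes "web_move n A B"
  shows "int n dvd writhe A - writhe B"
  using assms
proof cases
  case (turn p)
  then show ?thesis
    by (auto simp: turned_left_def turned_right_def Let_def writhe_no_crossing)
next
  case (pass_sink X)
  have "writhe (map (\<lambda>k. (f k, X)) ks) = int (length ks) * writhe [(0, X)]" for f :: "nat \<Rightarrow> nat" and ks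
    by (induction ks) (auto simp: algebra_simps)
  with pass_sink show ?thesis by simp
next
  case (pass_source X)
  have "writhe (map (\<lambda>k. (f k, X)) ks) = int (length ks) * writhe [(0, X)]" for f :: "nat \<Rightarrow> nat" and ks
    by (induction ks) (auto simp: algebra_simps)
  with pass_source show ?thesis by simp
qed (auto simp: curl_right_def curl_left_def sideways_left_def sideways_right_def doubleton_eq_iff)

lemma writhe_isotopic:
  assumes "web_isotopic n D D'"
  shows "int n dvd writhe D - writhe D'"
  using assms unfolding web_isotopic_def
proof (induction rule: equivclp_induct)
  case (step y z)
  have "int n dvd writhe y - writhe z"
    if "web_step n y z" for y z using that by cases (simp add: writhe_web_move)
  with step(2) have "int n dvd writhe y - writhe z" by (metis dvd_minus_iff minus_diff_eq)
  with step.IH show ?case using dvd_add by fastforce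
qed simp

section \<open>The homogeneous part of the bracket satisfies the bracket axioms\<close>

context bracket
begin

definition graded_bracket :: "disc diagram \<Rightarrow> rat fls" where
  "graded_bracket D = graded_part n (writhe D) (br D)"

text \<open>The factors \<open>root_q\<close> and \<open>inverse root_q\<close> compensate the
  writhes \<open>+1\<close> and \<open>-1\<close>, so all three terms lie in the degree belonging to
  the smoothing.\<close>

lemma graded_bracket_skein:
  assumes "web_diagram n (P @ placed i [(0, Pos)] @ Q)"
  shows "root_q * graded_bracket (P @ placed i [(0, Pos)] @ Q) - inverse root_q * graded_bracket (P @ placed i [(0, Neg)] @ Q)
    = (qvar n - inverse (qvar n)) * graded_bracket (P @ Q)"
proof -
  let ?w = "writhe (P @ Q)"
  let ?L = "br (P @ placed i [(0, Pos)] @ Q)" and ?R = "br (P @ placed i [(0, Neg)] @ Q)"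
  have s: "root_q = root_q powi 1" "inverse root_q = root_q powi (- 1)" by (simp_all add: power_int_minus)
  have a: "graded_part n ?w (root_q * ?L - inverse root_q * ?R)
      = root_q * graded_part n (?w + 1) ?L - inverse root_q * graded_part n (?w + - 1) ?R"
    by (subst (1 3) s(1), subst (1 2) s(2)) (simp only: graded_part_diff graded_part_root_q_times)
  have b: "graded_part n ?w ((qvar n - inverse (qvar n)) * br (P @ Q))
      = (qvar n - inverse (qvar n)) * graded_part n ?w (br (P @ Q))"
    using graded_part_qvar_times[of n ?w 1] by (simp add: left_diff_distrib graded_part_diff)
  have w: "writhe (P @ placed i [(0, Pos)] @ Q) = ?w + 1" "writhe (P @ placed i [(0, Neg)] @ Q) = ?w + - 1"
    by simp_all
  show ?thesis unfolding graded_bracket_def w a[symmetric] skein[OF assms] b ..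
qed

text \<open>In every relation the degree of the coefficient compensates the change of writhe modulo
  \<open>n\<close>. A curl of writhe 1 has a factor of degree \<open>n * n - 1\<close>, and a
  positive braid with \<open>l\<close> crossings has a coefficient of degree
  \<open>(1 - n) * l\<close>.\<close>

lemma graded_bracket_axioms: "web_bracket_axioms n graded_bracket"
  unfolding web_bracket_axioms_def
proof (intro conjI allI impI ballI)
  fix D assume "web_diagram n D"
  then show "graded_bracket D \<in> laurent_root_q"
    unfolding graded_bracket_def by (intro graded_part_laurent integral)
next
  fix D D' assume "web_diagram n D" "web_diagram n D'" "web_isotopic n D D'"
  then show "graded_bracket D = graded_bracket D'"
    unfolding graded_bracket_def using isotopy_invariant graded_part_cong[OF writhe_isotopic] by metis
next
  fix P i Q c assume c: "c \<in> {curl_right, curl_left :: _ \<Rightarrow> disc diagram}" and d: "web_diagram n (P @ placed i (c Pos) @ Q)"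
  have "writhe (c Pos) = 1" using c by (auto simp: curl_right_def curl_left_def)
  then have w: "int n dvd writhe (P @ placed i (c Pos) @ Q) + (int n * int n - 1) - writhe (P @ Q)" by simp
  show "graded_bracket (P @ placed i (c Pos) @ Q) = root_q powi (int n * int n - 1) * graded_bracket (P @ Q)"
    unfolding graded_bracket_def positive_curl[OF c d] graded_part_root_q_times graded_part_cong[OF w] ..
next
  fix P i Q c assume c: "c \<in> {curl_right, curl_left :: _ \<Rightarrow> disc diagram}" and d: "web_diagram n (P @ placed i (c Neg) @ Q)"
  have "writhe (c Neg) = - 1" using c by (auto simp: curl_right_def curl_left_def)
  then have w: "int n dvd writhe (P @ placed i (c Neg) @ Q) + (1 - int n * int n) - writhe (P @ Q)" by simp
  show "graded_bracket (P @ placed i (c Neg) @ Q) = root_q powi (1 - int n * int n) * graded_bracket (P @ Q)"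
    unfolding graded_bracket_def negative_curl[OF c d] graded_part_root_q_times graded_part_cong[OF w] ..
next
  fix P i Q and b :: "(nat \<Rightarrow> nat) \<Rightarrow> disc diagram"
  assume d: "web_diagram n (P @ placed i [(0, Node Sink), (0, Node Source)] @ Q)"
    and b: "\<forall>\<sigma>. \<sigma> permutes {..<n} \<longrightarrow> positive_braid n \<sigma> (b \<sigma>)"
  let ?w = "writhe (P @ Q)" and ?x = "- (root_q powi (1 - int n))"
  have "graded_part n ?w (?x ^ inversions n \<sigma> * br (P @ placed i (b \<sigma>) @ Q))
      = ?x ^ inversions n \<sigma> * graded_bracket (P @ placed i (b \<sigma>) @ Q)" if "\<sigma> permutes {..<n}" for \<sigma>
  proof -
    let ?l = "inversions n \<sigma>"
    have "writhe (b \<sigma>) = int ?l"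
      using b that writhe_braid_word unfolding positive_braid_def braid_word_def by metis
    then have w: "int n dvd ?w + (1 - int n) * int ?l - writhe (P @ placed i (b \<sigma>) @ Q)"
      by (simp add: algebra_simps)
    have "(root_q powi (1 - int n)) ^ ?l = root_q powi ((1 - int n) * int ?l)"
      by (simp only: power_int_mult power_int_of_nat)
    then have "graded_part n ?w ((root_q powi (1 - int n)) ^ ?l * f)
        = (root_q powi (1 - int n)) ^ ?l * graded_part n (writhe (P @ placed i (b \<sigma>) @ Q)) f" for f
      by (simp only: graded_part_root_q_times graded_part_cong[OF w])
    \<comment> \<open>The sign is split off because the shift rule applies to pure powers of
      \<open>root_q\<close>.\<close>
    moreover have "graded_part n v ((- y) ^ l * f) = (- 1) ^ l * graded_part n v (y ^ l * f)" for v y l f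
      by (cases "even l") (simp_all add: graded_part_uminus)
    moreover have "(- y) ^ l * f = (- 1) ^ l * (y ^ l * f)" for y f :: "rat fls" and l
      by (cases "even l") simp_all
    ultimately show ?thesis unfolding graded_bracket_def by metis
  qed
  then have "graded_part n ?w (\<Sum>\<sigma> | \<sigma> permutes {..<n}. ?x ^ inversions n \<sigma> * br (P @ placed i (b \<sigma>) @ Q))
      = (\<Sum>\<sigma> | \<sigma> permutes {..<n}. ?x ^ inversions n \<sigma> * graded_bracket (P @ placed i (b \<sigma>) @ Q))"
    by (simp add: graded_part_sum)
  moreover have "writhe (P @ placed i [(0, Node Sink), (0, Node Source)] @ Q) = ?w" by simp
  ultimately show "graded_bracket (P @ placed i [(0, Node Sink), (0, Node Source)] @ Q) = qvar n ^ (n * (n - 1)) *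
      (\<Sum>\<sigma> | \<sigma> permutes {..<n}. ?x ^ inversions n \<sigma> * graded_bracket (P @ placed i (b \<sigma>) @ Q))"
    using sink_source[OF d, of b] b unfolding graded_bracket_def[of "P @ placed i [_, _] @ Q"]
    by (simp only: graded_part_qvar_times)
next
  fix P i Q d assume d: "web_diagram n (P @ placed i (circle d) @ Q)"
  have w: "writhe (P @ placed i (circle d) @ Q) = writhe (P @ Q)" by (simp add: circle_def)
  show "graded_bracket (P @ placed i (circle d) @ Q) = qint n n * graded_bracket (P @ Q)"
    using n_ge_2 unfolding graded_bracket_def trivial_circle[OF d] w by (simp only: graded_part_qint_times)
next
  show "graded_bracket [] = 1" by (simp add: graded_bracket_def empty_diagram)
qed (rule graded_bracket_skein)

end

section \<open>Singular links\<close>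

text \<open>Stated for any slice with two downward strands above and below, so that it serves
  crossings in the skein relations and vertices in the integrality proof.\<close>

lemma upright_slice_context:
  assumes "singular_diagram (P @ (i, p) # Q)"
    and "top_of vertex_ends p = [Down, Down]" "bottom_of vertex_ends p = [Down, Down]"
  shows upright_slice_replace: "tangle vertex_ends [Down, Down] A [Down, Down] \<Longrightarrow> singular_diagram (P @ placed i A @ Q)"
    and upright_slice_hole: "n \<ge> 2 \<Longrightarrow> hole n i 2 (web_of n P) (web_of n Q)"
proof -
  from assms obtain l r where lr: "length l = i" "tangle vertex_ends [] P (l @ [Down, Down] @ r)"
    "tangle vertex_ends (l @ [Down, Down] @ r) Q []"
    unfolding singular_diagram_def closed_diagram_def tangle_append_iff[of _ _ P] tangle_Cons_iff by auto
  show "singular_diagram (P @ placed i A @ Q)" if "tangle vertex_ends [Down, Down] A [Down, Down]"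
    using closed_placed[OF lr(2) that lr(3)] lr(1) unfolding singular_diagram_def by simp
  show "hole n i 2 (web_of n P) (web_of n Q)" if "n \<ge> 2"
    unfolding hole_def using lr(1) tangle_web_of[OF that lr(2)] tangle_web_of[OF that lr(3)]
    by (auto simp: numeral_2_eq_2)
qed

lemma qint_nonzero:
  assumes "n \<ge> 1" "k \<ge> 1"
  shows "qint n k \<noteq> 0"
proof
  assume "qint n k = 0"
  then have "qvar n ^ k - inverse (qvar n) ^ k = 0" using qint_eq[OF assms(1), of k] by simp
  \<comment> \<open>The numerator of \<open>qint n k\<close> is the denominator for
    \<open>n * k\<close> in place of \<open>n\<close>, which is already known to be nonzero.\<close>
  moreover have "qvar n ^ k = qvar (n * k)" by (simp add: qvar_def power_mult)
  moreover have "inverse (qvar n) ^ k = inverse (qvar n ^ k)" by (rule power_inverse)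
  ultimately show False using qvar_minus_inverse_nonzero[of "n * k"] assms by simp
qed

lemma qfact_nonzero: "n \<ge> 1 \<Longrightarrow> qfact n k \<noteq> 0"
  unfolding qfact_def by (simp add: qint_nonzero)

section \<open>Integral Laurent polynomials\<close>

lemma laurent_root_q_shift:
  assumes "f \<in> laurent_root_q"
  shows "root_q powi k * f \<in> laurent_root_q"
proof -
  have "{m. fls_nth f (m - k) \<noteq> 0} = (\<lambda>m. m + k) ` {m. fls_nth f m \<noteq> 0}"
    by (auto simp: image_iff) (metis diff_add_cancel)
  with assms show ?thesis unfolding laurent_root_q_def by (auto simp only: root_q_powi_times_nth mem_Collect_eq)
qed

lemma laurent_q_diff:
  assumes "f \<in> laurent_q n" "g \<in> laurent_q n"
  shows "f - g \<in> laurent_q n"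
proof -
  have "{k. fls_nth (f - g) k \<noteq> 0} \<subseteq> {k. fls_nth f k \<noteq> 0} \<union> {k. fls_nth g k \<noteq> 0}" by auto
  with assms show ?thesis unfolding laurent_q_def laurent_root_q_def
    by (auto dest: finite_subset)
qed

lemma laurent_q_qvar_times:
  assumes "f \<in> laurent_q n"
  shows "qvar n * f \<in> laurent_q n"
proof -
  have "int n dvd k" if "fls_nth f (k - int n) \<noteq> 0" for k
  proof -
    have "int n dvd k - int n" using assms that unfolding laurent_q_def by blast
    from dvd_add[OF this dvd_refl] show ?thesis by simp
  qed
  with assms show ?thesis
    unfolding laurent_q_def qvar_eq_powi(1) using laurent_root_q_shift by (auto simp only: root_q_powi_times_nth mem_Collect_eq)
qed

text \<open>Exponents congruent to \<open>- w\<close> modulo \<open>n\<close> become multiples of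
  \<open>n\<close> after a shift by \<open>w\<close>; this is the effect of the writhe factor in
  \<open>singular_bracket\<close>.\<close>

lemma laurent_q_graded_part:
  assumes "f \<in> laurent_root_q" "graded_part n w f = f"
  shows "root_q powi w * f \<in> laurent_q n"
proof -
  have "int n dvd k" if "fls_nth f (k - w) \<noteq> 0" for k
    using that assms(2) graded_part_nth[of n w f "k - w"] by (metis diff_add_cancel)
  with laurent_root_q_shift[OF assms(1)] show ?thesis
    unfolding laurent_q_def by (auto simp only: root_q_powi_times_nth mem_Collect_eq)
qed

section \<open>Relations for the bracket of singular links\<close>

context bracket
begin

text \<open>The formula for a resolved vertex is solved for the crossing. Its scalar cancels the
  normalization of one vertex, and its \<open>root_q\<close> is the writhe factor of the
  crossing.\<close>

lemma singular_bracket_positive: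
  assumes "singular_diagram (P @ (i, p) # Q)"
    and "top_of vertex_ends p = [Down, Down]" "bottom_of vertex_ends p = [Down, Down]"
  shows "singular_bracket n br (P @ [(i, Pos)] @ Q)
    = qvar n * singular_bracket n br (P @ Q) - singular_bracket n br (P @ [(i, Node Double_Point)] @ Q)"
proof -
  note h = upright_slice_hole[OF assms n_ge_2]
  let ?C = "qfact n (n - 2) * qvar n ^ (n * (n - 1) div 2)"
  have C: "?C \<noteq> 0" using qfact_nonzero n_ge_2 by simp
  have *: "b1 / C ^ v * s powi (w + 1) = q * (b0 / C ^ v * s powi w) - (C * (q * b0 - s * b1)) / C ^ Suc v * s powi w"
    if "C \<noteq> 0" "s \<noteq> 0" for b0 b1 C s q :: "rat fls" and v w
    using that by (simp add: power_int_add field_simps)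
  show ?thesis
    using *[OF C fls_X_nonzero, of "br (web_of n P @ placed i [(0, Pos)] @ web_of n Q)"
        "num_nodes (P @ Q)" "writhe (P @ Q)" "qvar n" "br (web_of n P @ web_of n Q)"]
    unfolding singular_bracket_def resolved_vertex_bracket[OF h, symmetric]
    by (simp add: add_ac del: fls_X_power_int power_Suc)
qed

text \<open>With the writhe factors included, the skein relation expresses the difference of the two
  crossings as \<open>q - inverse q\<close> times the smoothing. Subtracting this from the relation
  for the positive crossing leaves the coefficient \<open>inverse q\<close>.\<close>

lemma singular_bracket_negative:
  assumes "singular_diagram (P @ (i, p) # Q)"
    and "top_of vertex_ends p = [Down, Down]" "bottom_of vertex_ends p = [Down, Down]"
  shows "singular_bracket n br (P @ [(i, Neg)] @ Q)
    = inverse (qvar n) * singular_bracket n br (P @ Q) - singular_bracket n br (P @ [(i, Node Double_Point)] @ Q)"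
proof -
  let ?C = "qfact n (n - 2) * qvar n ^ (n * (n - 1) div 2)"
  have "tangle vertex_ends [Down, Down] [(0, Pos)] [Down, Down]" by (auto simp: tangle_Cons_iff)
  from web_diagram_web_of[OF n_ge_2 upright_slice_replace[OF assms this]]
  have s: "root_q * br (web_of n P @ placed i [(0, Pos)] @ web_of n Q)
      - inverse root_q * br (web_of n P @ placed i [(0, Neg)] @ web_of n Q)
      = (qvar n - inverse (qvar n)) * br (web_of n P @ web_of n Q)"
    by (intro skein) simp
  have *: "b2 / D * s powi (w - 1) = b1 / D * s powi (w + 1) - (q - inverse q) * (b0 / D * s powi w)"
    if "s * b1 - inverse s * b2 = (q - inverse q) * b0" "s \<noteq> 0" for b0 b1 b2 D s q :: "rat fls" and w
  proof -
    have "b2 / D * s powi (w - 1) = (inverse s * b2) / D * s powi w"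
      using that(2) by (simp add: power_int_diff divide_inverse)
    also have "inverse s * b2 = s * b1 - (q - inverse q) * b0" unfolding that(1)[symmetric] by simp
    also have "\<dots> / D * s powi w = (s * b1) / D * s powi w - (q - inverse q) * (b0 / D * s powi w)"
      by (simp only: diff_divide_distrib left_diff_distrib) (simp add: divide_inverse algebra_simps)
    also have "(s * b1) / D * s powi w = b1 / D * s powi (w + 1)"
      using that(2) by (simp add: power_int_add divide_inverse)
    finally show ?thesis .
  qed
  have "singular_bracket n br (P @ [(i, Neg)] @ Q)
      = singular_bracket n br (P @ [(i, Pos)] @ Q) - (qvar n - inverse (qvar n)) * singular_bracket n br (P @ Q)"
    using *[OF s fls_X_nonzero, of "?C ^ num_nodes (P @ Q)" "writhe (P @ Q)"]
    unfolding singular_bracket_def by (simp add: add_ac add_diff_eq del: fls_X_power_int)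
  then show ?thesis unfolding singular_bracket_positive[OF assms] by (simp add: left_diff_distrib)
qed

lemma singular_bracket_curl:
  assumes "c \<in> {curl_right, curl_left}"
  shows "singular_diagram (P @ placed i (c Pos) @ Q) \<Longrightarrow>
      singular_bracket n br (P @ placed i (c Pos) @ Q) = qvar n ^ n * singular_bracket n br (P @ Q)"
    and "singular_diagram (P @ placed i (c Neg) @ Q) \<Longrightarrow>
      singular_bracket n br (P @ placed i (c Neg) @ Q) = inverse (qvar n) ^ n * singular_bracket n br (P @ Q)"
proof -
  \<comment> \<open>\<open>c'\<close> is the same curl at the type of web diagrams; the variable
    \<open>c\<close> is fixed at the type of singular diagrams.\<close>
  obtain c' :: "disc piece \<Rightarrow> disc diagram" where c': "c' \<in> {curl_right, curl_left}"
    "web_of n (placed i (c Pos)) = placed i (c' Pos)" "web_of n (placed i (c Neg)) = placed i (c' Neg)"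
    using assms by (auto simp: curl_right_def curl_left_def intro: that[of curl_right] that[of curl_left])
  have c: "writhe (c Pos) = 1" "writhe (c Neg) = - 1" "num_nodes (c Pos) = 0" "num_nodes (c Neg) = 0"
    using assms by (auto simp: curl_right_def curl_left_def)
  have *: "s powi a * s powi (w + e) = s powi (a + e) * s powi w" if "s \<noteq> 0" for s :: "rat fls" and a e w
    using that by (simp add: power_int_add)
  show "singular_bracket n br (P @ placed i (c Pos) @ Q) = qvar n ^ n * singular_bracket n br (P @ Q)"
    if "singular_diagram (P @ placed i (c Pos) @ Q)"
  proof -
    have "br (web_of n P @ placed i (c' Pos) @ web_of n Q) = root_q powi (int n * int n - 1) * br (web_of n P @ web_of n Q)"
      using web_diagram_web_of[OF n_ge_2 that] c' by (intro positive_curl) simp_all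
    then show ?thesis
      using *[OF fls_X_nonzero, of "int n * int n - 1" "writhe (P @ Q)" 1]
      unfolding singular_bracket_def qvar_power_eq_powi by (simp add: c c' add_ac del: fls_X_power_int)
  qed
  show "singular_bracket n br (P @ placed i (c Neg) @ Q) = inverse (qvar n) ^ n * singular_bracket n br (P @ Q)"
    if "singular_diagram (P @ placed i (c Neg) @ Q)"
  proof -
    have "br (web_of n P @ placed i (c' Neg) @ web_of n Q) = root_q powi (1 - int n * int n) * br (web_of n P @ web_of n Q)"
      using web_diagram_web_of[OF n_ge_2 that] c' by (intro negative_curl) simp_all
    then show ?thesis
      using *[OF fls_X_nonzero, of "1 - int n * int n" "writhe (P @ Q)" "- 1"]
      unfolding singular_bracket_def inverse_qvar_power_eq_powi by (simp add: c c' add_ac add_diff_eq del: fls_X_power_int)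
  qed
qed

lemma singular_bracket_circle:
  assumes "singular_diagram (P @ placed i (circle d) @ Q)"
  shows "singular_bracket n br (P @ placed i (circle d) @ Q) = qint n n * singular_bracket n br (P @ Q)"
proof -
  have c: "web_of n (placed i (circle d)) = placed i (circle d)" "writhe (circle d :: vertex diagram) = 0"
    "num_nodes (circle d :: vertex diagram) = 0"
    by (simp_all add: circle_def)
  have "br (web_of n P @ placed i (circle d) @ web_of n Q) = qint n n * br (web_of n P @ web_of n Q)"
    using web_diagram_web_of[OF n_ge_2 assms] c by (intro trivial_circle) simp
  then show ?thesis unfolding singular_bracket_def by (simp add: c del: fls_X_power_int)
qed

lemma singular_bracket_empty: "singular_bracket n br [] = 1"
  by (simp add: singular_bracket_def empty_diagram)

text \<open>Induction on the number of vertices: relation (i), solved for the vertex, expresses the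
  bracket by two diagrams with one vertex fewer. Without vertices, homogeneity of \<open>br\<close>
  and the writhe factor leave only exponents divisible by \<open>n\<close>.\<close>

lemma singular_bracket_laurent:
  assumes homogeneous: "\<And>D. web_diagram n D \<Longrightarrow> graded_bracket D = br D" and "singular_diagram D"
  shows "singular_bracket n br D \<in> laurent_q n"
  using assms(2)
proof (induction "num_nodes D" arbitrary: D)
  case 0
  note web = web_diagram_web_of[OF n_ge_2 0(2)]
  have "root_q powi writhe (web_of n D) * br (web_of n D) \<in> laurent_q n"
    using laurent_q_graded_part[OF integral[OF web]] homogeneous[OF web] unfolding graded_bracket_def by blast
  then show ?case using 0(1) unfolding singular_bracket_def by (simp add: mult.commute del: fls_X_power_int)
next
  case (Suc v)
  have "\<exists>x \<in> set D. \<exists>u. snd x = Node u"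
  proof (rule ccontr)
    assume "\<not> ?thesis"
    then have "num_nodes D = 0" unfolding num_nodes_def by (auto simp: filter_empty_conv)
    with Suc.hyps(2) show False by simp
  qed
  then obtain i u where "(i, Node u) \<in> set D" by auto
  then obtain P Q where "D = P @ (i, Node u) # Q" by (meson split_list)
  moreover have "u = Double_Point" by (cases u)
  ultimately have D: "D = P @ (i, Node Double_Point) # Q" by simp
  have s: "singular_diagram (P @ (i, Node Double_Point) # Q)" using Suc.prems D by simp
  have "singular_diagram (P @ placed i [(0, Pos)] @ Q)" "singular_diagram (P @ placed i [] @ Q)"
    by (rule upright_slice_replace[OF s]; auto simp: tangle_Cons_iff)+
  then have "singular_bracket n br (P @ [(i, Pos)] @ Q) \<in> laurent_q n" "singular_bracket n br (P @ Q) \<in> laurent_q n"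
    using Suc.hyps by (auto simp: D)
  moreover have "singular_bracket n br D = qvar n * singular_bracket n br (P @ Q) - singular_bracket n br (P @ [(i, Pos)] @ Q)"
    using singular_bracket_positive[OF s] by (simp add: D)
  ultimately show ?case by (simp only: laurent_q_diff laurent_q_qvar_times)
qed

end

theorem theorem6:
  fixes n :: nat and br :: "disc diagram \<Rightarrow> rat fls"
  assumes "n \<ge> 2" and "web_bracket n br"
  shows
    "(\<forall>D. singular_diagram D \<longrightarrow> singular_bracket n br D \<in> laurent_q n) \<and>
     (\<forall>P i Q. singular_diagram (P @ placed i [(0, Pos)] @ Q) \<longrightarrow>
        singular_bracket n br (P @ placed i [(0, Pos)] @ Q)
          = qvar n * singular_bracket n br (P @ Q)
            - singular_bracket n br (P @ placed i [(0, Node Double_Point)] @ Q)) \<and>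
     (\<forall>P i Q. singular_diagram (P @ placed i [(0, Neg)] @ Q) \<longrightarrow>
        singular_bracket n br (P @ placed i [(0, Neg)] @ Q)
          = inverse (qvar n) * singular_bracket n br (P @ Q)
            - singular_bracket n br (P @ placed i [(0, Node Double_Point)] @ Q)) \<and>
     (\<forall>P i Q. \<forall>curl \<in> {curl_right, curl_left}.
        (singular_diagram (P @ placed i (curl Pos) @ Q) \<longrightarrow>
           singular_bracket n br (P @ placed i (curl Pos) @ Q)
             = qvar n ^ n * singular_bracket n br (P @ Q)) \<and>
        (singular_diagram (P @ placed i (curl Neg) @ Q) \<longrightarrow>
           singular_bracket n br (P @ placed i (curl Neg) @ Q)
             = inverse (qvar n) ^ n * singular_bracket n br (P @ Q))) \<and>
     (\<forall>P i Q d. singular_diagram (P @ placed i (circle d) @ Q) \<longrightarrow>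
        singular_bracket n br (P @ placed i (circle d) @ Q)
          = qint n n * singular_bracket n br (P @ Q)) \<and>
     singular_bracket n br [] = 1 \<and>
     (\<forall>d. singular_bracket n br (circle d) = qint n n)"
proof -
  have axioms: "web_bracket_axioms n br"
    and unique: "web_bracket_axioms n br' \<Longrightarrow> web_diagram n D \<Longrightarrow> br' D = br D" for br' D
    using assms(2) unfolding web_bracket_def by blast+
  interpret bracket n br using assms(1) axioms by (rule bracket.intro)
  have upright: "top_of vertex_ends p = [Down, Down]" "bottom_of vertex_ends p = [Down, Down]"
    if "p \<in> {Pos, Neg}" for p using that by auto
  have circle: "singular_diagram (circle d)" for d
    unfolding singular_diagram_def closed_diagram_def circle_def by (auto simp: tangle_Cons_iff)
  show ?thesis
  proof (intro conjI allI impI ballI)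
    \<comment> \<open>\<open>graded_bracket\<close> satisfies the axioms as well, so uniqueness
      makes it equal to \<open>br\<close> on web diagrams, which is the homogeneity required
      here.\<close>
    show "singular_bracket n br D \<in> laurent_q n" if "singular_diagram D" for D
      using unique[OF graded_bracket_axioms] that by (rule singular_bracket_laurent)
  next
    fix P i Q assume "singular_diagram (P @ placed i [(0, Pos)] @ Q)"
    then show "singular_bracket n br (P @ placed i [(0, Pos)] @ Q)
        = qvar n * singular_bracket n br (P @ Q) - singular_bracket n br (P @ placed i [(0, Node Double_Point)] @ Q)"
      using singular_bracket_positive[of P i Pos Q] by simp
  next
    fix P i Q assume "singular_diagram (P @ placed i [(0, Neg)] @ Q)"
    then show "singular_bracket n br (P @ placed i [(0, Neg)] @ Q)
        = inverse (qvar n) * singular_bracket n br (P @ Q) - singular_bracket n br (P @ placed i [(0, Node Double_Point)] @ Q)"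
      using singular_bracket_negative[of P i Neg Q] by simp
  next
    show "singular_bracket n br (circle d) = qint n n" for d
      using singular_bracket_circle[of "[]" 0 d "[]"] circle[of d] by (simp add: circle_def singular_bracket_empty)
  qed (simp_all only: singular_bracket_curl singular_bracket_circle singular_bracket_empty)
qed

end
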